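(* Let $K\subseteq[-1,1]$ be a set having $0$ as a limit point. The functor $[\cdot]_K$ from the category of C$^\ast$-algebras (with $\ast$-homomorphisms) to itself is exact; that is, for every short exact sequence of C$^\ast$-algebras $$0\longrightarrow\mathcal{A}\overset{f}{\longrightarrow}\mathcal{B}\overset{g}{\longrightarrow}\mathcal{C}\longrightarrow 0$$ the sequence $$0\longrightarrow[\mathcal{A}]_K\overset{\hat f}{\longrightarrow}[\mathcal{B}]_K\overset{\hat g}{\longrightarrow}[\mathcal{C}]_K\longrightarrow 0$$ is a short exact sequence of C$^\ast$-algebras.
   Context: All C$^\ast$-algebras are complex. For a C$^\ast$-algebra $\mathcal{A}$, $\mathcal{A}[Z]$ is the $\ast$-algebra of all formal power series $F(Z)=\sum_{n=0}^\infty a_nZ^n$ with $a_n\in\mathcal{A}$ and $\sum_{n=0}^\infty\|a_n\|<\infty$, with coefficientwise linear operations, Cauchy product $(\sum a_nZ^n)(\sum b_nZ^n)=\sum_n(\sum_{k=0}^n a_kb_{n-k})Z^n$, and involution $(\sum a_nZ^n)^\ast=\sum a_n^\ast Z^n$. For $t\in[-1,1]$, $F(t)=\sum_{n=0}^\infty a_nt^n\in\mathcal{A}$. The norm $\|F\|_K=\sup_{t\in K}\|F(t)\|$ makes $\mathcal{A}[Z]$ a pre-C$^\ast$-algebra (a normed $\ast$-algebra with $\|F^\ast F\|_K=\|F\|_K^2$), and its completion is the C$^\ast$-algebra $[\mathcal{A}]_K$ (the Cauchy extension of $\mathcal{A}$). A $\ast$-homomorphism $f:\mathcal{A}\to\mathcal{B}$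 induces the contractive $\ast$-homomorphism $\tilde f:\mathcal{A}[Z]\to\mathcal{B}[Z]$, $\tilde f(\sum a_nZ^n)=\sum f(a_n)Z^n$, and $\hat f=[f]_K:[\mathcal{A}]_K\to[\mathcal{B}]_K$ is its continuous extension. *)

theory Defs
  imports "HOL-Analysis.Analysis" "HOL-Probability.Discrete_Topology"
begin

section \<open>C*-algebras\<close>

text \<open>
  Complex C*-algebras, not necessarily unital. The real scalar multiplication inherited from
  \<^class>\<open>real_normed_algebra\<close> is the restriction of the complex one.
\<close>

class cstar_algebra = real_normed_algebra + banach +
  fixes scaleC :: "complex \<Rightarrow> 'a \<Rightarrow> 'a"  (infixr "*\<^sub>C" 75)
    and star :: "'a \<Rightarrow> 'a"
  assumes scaleC_add_right: "c *\<^sub>C (x + y) = c *\<^sub>C x + c *\<^sub>C y"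
    and scaleC_add_left: "(c + d) *\<^sub>C x = c *\<^sub>C x + d *\<^sub>C x"
    and scaleC_scaleC: "c *\<^sub>C d *\<^sub>C x = (c * d) *\<^sub>C x"
    and scaleC_of_real: "complex_of_real r *\<^sub>C x = r *\<^sub>R x"
    and mult_scaleC_left: "(c *\<^sub>C x) * y = c *\<^sub>C (x * y)"
    and mult_scaleC_right: "x * (c *\<^sub>C y) = c *\<^sub>C (x * y)"
    and norm_scaleC: "norm (c *\<^sub>C x) = cmod c * norm x"
    and star_add: "star (x + y) = star x + star y"
    and star_scaleC: "star (c *\<^sub>C x) = cnj c *\<^sub>C star x"
    and star_mult: "star (x * y) = star y * star x"
    and star_star: "star (star x) = x"
    and norm_star_mult_self: "norm (star x * x) = (norm x)\<^sup>2"

instantiation complex :: cstar_algebra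
begin

definition scaleC_complex :: "complex \<Rightarrow> complex \<Rightarrow> complex" where
  "scaleC_complex c x = c * x"

definition star_complex :: "complex \<Rightarrow> complex" where
  "star_complex = cnj"

instance
  by standard
    (simp_all add: scaleC_complex_def star_complex_def algebra_simps norm_mult power2_eq_square
      scaleR_conv_of_real)

end

lemma norm_star:
  fixes x :: "'a::cstar_algebra"
  shows "norm (star x) = norm x"
proof -
  have *: "norm y \<le> norm (star y)" for y :: 'a
  proof (cases "y = 0")
    case False
    have "norm y * norm y \<le> norm (star y) * norm y"
      using norm_star_mult_self[of y] norm_mult_ineq[of "star y" y] by (simp add: power2_eq_square)
    with False show ?thesis by simp
  qed auto
  show ?thesis using *[of x] *[of "star x"] by (simp add: star_star)
qed

lemma bounded_linear_star: "bounded_linear (star :: 'a::cstar_algebra \<Rightarrow> 'a)"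
proof (rule bounded_linear_intro[where K = 1])
  show "star (r *\<^sub>R x) = r *\<^sub>R star x" for r and x :: 'a
    using star_scaleC[of "of_real r" x] by (simp add: scaleC_of_real)
qed (simp_all add: star_add norm_star)

lemma bounded_linear_scaleC: "bounded_linear (scaleC c :: 'a::cstar_algebra \<Rightarrow> 'a)"
proof (rule bounded_linear_intro[where K = "cmod c"])
  show "c *\<^sub>C (r *\<^sub>R x) = r *\<^sub>R (c *\<^sub>C x)" for r and x :: 'a
    using scaleC_scaleC[of c "of_real r" x] scaleC_scaleC[of "of_real r" c x]
    by (simp add: scaleC_of_real mult.commute)
qed (simp_all add: scaleC_add_right norm_scaleC mult.commute)

text \<open>
  The objects of the category of C*-algebras are norm-closed *-subalgebras of types of class
  \<^class>\<open>cstar_algebra\<close>. Every such set is a C*-algebra, and every C*-algebra given as a type is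
  covered by \<^term>\<open>UNIV\<close>. Morphisms and exact sequences are relativised to these carriers.
  Homomorphisms are purely algebraic: no continuity is required.
\<close>

definition cstar :: "'a::cstar_algebra set \<Rightarrow> bool" where
  "cstar A \<longleftrightarrow>
     closed A \<and> 0 \<in> A \<and>
     (\<forall>x\<in>A. \<forall>y\<in>A. x + y \<in> A \<and> x * y \<in> A) \<and>
     (\<forall>x\<in>A. \<forall>c. c *\<^sub>C x \<in> A) \<and>
     (\<forall>x\<in>A. star x \<in> A)"

definition star_hom :: "'a::cstar_algebra set \<Rightarrow> 'b::cstar_algebra set \<Rightarrow> ('a \<Rightarrow> 'b) \<Rightarrow> bool" where
  "star_hom A B f \<longleftrightarrow>
     f ` A \<subseteq> B \<and>
     (\<forall>x\<in>A. \<forall>y\<in>A. f (x + y) = f x + f y \<and> f (x * y) = f x * f y) \<and>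
     (\<forall>x\<in>A. \<forall>c. f (c *\<^sub>C x) = c *\<^sub>C f x) \<and>
     (\<forall>x\<in>A. f (star x) = star (f x))"

definition short_exact ::
  "'a::cstar_algebra set \<Rightarrow> ('a \<Rightarrow> 'b) \<Rightarrow> 'b::cstar_algebra set \<Rightarrow> ('b \<Rightarrow> 'c) \<Rightarrow> 'c::cstar_algebra set \<Rightarrow> bool"
  where
  "short_exact A f B g C \<longleftrightarrow>
     cstar A \<and> cstar B \<and> cstar C \<and> star_hom A B f \<and> star_hom B C g \<and>
     inj_on f A \<and> f ` A = {b \<in> B. g b = 0} \<and> g ` B = C"

lemma cstar_UNIV: "cstar (UNIV :: 'a::cstar_algebra set)"
  by (simp add: cstar_def)


section \<open>Bounded continuous functions into a C*-algebra\<close>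

text \<open>
  These form a C*-algebra under pointwise operations and the supremum norm; this serves as the
  ambient type of Cauchy extensions.
\<close>

lemma times_cont: "f \<in> bcontfun \<Longrightarrow> g \<in> bcontfun \<Longrightarrow> (\<lambda>x. f x * g x) \<in> bcontfun"
  for f g :: "'a::topological_space \<Rightarrow> 'b::real_normed_algebra"
proof -
  assume "f \<in> bcontfun" "g \<in> bcontfun"
  then obtain M N where "\<And>x. norm (f x) \<le> M" "\<And>x. norm (g x) \<le> N"
    and c: "continuous_on UNIV f" "continuous_on UNIV g"
    by (auto simp: bcontfun_def bounded_iff)
  then have "norm (f x * g x) \<le> M * N" for x
    by (meson mult_mono' norm_ge_zero norm_mult_ineq order_trans)
  with c show ?thesis by (intro bcontfun_normI continuous_intros)
qed

lemma bounded_linear_cont: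
  assumes "bounded_linear h" and "f \<in> bcontfun"
  shows "(\<lambda>x. h (f x)) \<in> bcontfun"
proof -
  have "bounded (h ` range f)"
    using assms by (intro bounded_linear_image) (auto simp: bcontfun_def)
  moreover have "continuous_on UNIV (\<lambda>x. h (f x))"
    using assms by (intro bounded_linear.continuous_on[OF assms(1)]) (auto simp: bcontfun_def)
  ultimately show ?thesis by (simp add: bcontfun_def image_image)
qed

instantiation bcontfun :: (topological_space, real_normed_algebra) real_normed_algebra
begin

definition times_bcontfun :: "('a \<Rightarrow>\<^sub>C 'b) \<Rightarrow> ('a \<Rightarrow>\<^sub>C 'b) \<Rightarrow> 'a \<Rightarrow>\<^sub>C 'b" where
  "times_bcontfun f g = Bcontfun (\<lambda>x. f x * g x)"

lemma apply_times_bcontfun [simp]: "apply_bcontfun (f * g) x = f x * g x"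
  for f g :: "'a \<Rightarrow>\<^sub>C 'b"
  by (simp add: times_bcontfun_def Bcontfun_inverse times_cont apply_bcontfun)

instance
proof
  fix f g h :: "'a \<Rightarrow>\<^sub>C 'b" and r :: real
  show "norm (f * g) \<le> norm f * norm g"
  proof (rule norm_bound)
    fix x
    show "norm ((f * g) x) \<le> norm f * norm g"
      using norm_mult_ineq[of "f x" "g x"] norm_bounded[of f x] norm_bounded[of g x]
      by (simp, meson mult_mono' norm_ge_zero order_trans)
  qed
qed (auto intro!: bcontfun_eqI simp: algebra_simps)

end

instance bcontfun :: (metric_space, banach) banach ..

instantiation bcontfun :: (metric_space, cstar_algebra) cstar_algebra
begin

definition scaleC_bcontfun :: "complex \<Rightarrow> ('a \<Rightarrow>\<^sub>C 'b) \<Rightarrow> 'a \<Rightarrow>\<^sub>C 'b" where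
  "scaleC_bcontfun c f = Bcontfun (\<lambda>x. c *\<^sub>C f x)"

definition star_bcontfun :: "('a \<Rightarrow>\<^sub>C 'b) \<Rightarrow> 'a \<Rightarrow>\<^sub>C 'b" where
  "star_bcontfun f = Bcontfun (\<lambda>x. star (f x))"

lemma apply_scaleC_bcontfun [simp]: "apply_bcontfun (c *\<^sub>C f) x = c *\<^sub>C f x"
  for f :: "'a \<Rightarrow>\<^sub>C 'b"
  by (simp add: scaleC_bcontfun_def Bcontfun_inverse apply_bcontfun
      bounded_linear_cont[OF bounded_linear_scaleC])

lemma apply_star_bcontfun [simp]: "apply_bcontfun (star f) x = star (f x)"
  for f :: "'a \<Rightarrow>\<^sub>C 'b"
  by (simp add: star_bcontfun_def Bcontfun_inverse apply_bcontfun
      bounded_linear_cont[OF bounded_linear_star])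

instance
proof
  fix f g :: "'a \<Rightarrow>\<^sub>C 'b" and c d :: complex and r :: real
  have le: "norm (c *\<^sub>C f) \<le> cmod c * norm f" for c and f :: "'a \<Rightarrow>\<^sub>C 'b"
    by (rule norm_bound) (simp add: norm_scaleC mult_left_mono norm_bounded)
  show one: "complex_of_real r *\<^sub>C f = r *\<^sub>R f" for r and f :: "'a \<Rightarrow>\<^sub>C 'b"
    by (auto intro!: bcontfun_eqI simp: scaleC_of_real)
  show scl: "c *\<^sub>C d *\<^sub>C f = (c * d) *\<^sub>C f" for c d and f :: "'a \<Rightarrow>\<^sub>C 'b"
    by (auto intro!: bcontfun_eqI simp: scaleC_scaleC)
  show "norm (c *\<^sub>C f) = cmod c * norm f"
  proof (cases "c = 0")
    case True
    then show ?thesis using le[of c f] by simp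
  next
    case False
    have "norm f = norm (inverse c *\<^sub>C c *\<^sub>C f)"
      using False one[of 1 f] by (simp add: scl)
    also have "\<dots> \<le> inverse (cmod c) * norm (c *\<^sub>C f)"
      using le[of "inverse c" "c *\<^sub>C f"] by (simp add: norm_inverse)
    finally have "cmod c * norm f \<le> norm (c *\<^sub>C f)"
      using False by (simp add: field_simps)
    with le[of c f] show ?thesis by simp
  qed
  show "norm (star f * f) = (norm f)\<^sup>2"
  proof (rule antisym)
    show "norm (star f * f) \<le> (norm f)\<^sup>2"
      by (rule norm_bound) (simp add: norm_star_mult_self norm_bounded)
    have "norm f \<le> sqrt (norm (star f * f))"
    proof (rule norm_bound)
      fix x
      have "(norm (f x))\<^sup>2 \<le> norm (star f * f)"
        using norm_bounded[of "star f * f" x] by (simp add: norm_star_mult_self)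
      then show "norm (f x) \<le> sqrt (norm (star f * f))"
        by (simp add: real_le_rsqrt)
    qed
    then show "(norm f)\<^sup>2 \<le> norm (star f * f)"
      by (metis norm_ge_zero power_mono real_sqrt_pow2)
  qed
qed (auto intro!: bcontfun_eqI simp: scaleC_add_right scaleC_add_left mult_scaleC_left
      mult_scaleC_right star_add star_scaleC star_mult star_star)

end


section \<open>Absolutely summable power series\<close>

text \<open>
  A power series \<open>\<Sum>a\<^sub>n Z\<^sup>n\<close> is represented by its coefficient sequence; \<open>cps A\<close> is \<open>A[Z]\<close>.
\<close>

definition cps :: "'a::cstar_algebra set \<Rightarrow> (nat \<Rightarrow> 'a) set" where
  "cps A = {a. (\<forall>n. a n \<in> A) \<and> summable (\<lambda>n. norm (a n))}"

definition cps_add :: "(nat \<Rightarrow> 'a::cstar_algebra) \<Rightarrow> (nat \<Rightarrow> 'a) \<Rightarrow> nat \<Rightarrow> 'a" where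
  "cps_add a b = (\<lambda>n. a n + b n)"

definition cps_scale :: "complex \<Rightarrow> (nat \<Rightarrow> 'a::cstar_algebra) \<Rightarrow> nat \<Rightarrow> 'a" where
  "cps_scale c a = (\<lambda>n. c *\<^sub>C a n)"

definition cps_mult :: "(nat \<Rightarrow> 'a::cstar_algebra) \<Rightarrow> (nat \<Rightarrow> 'a) \<Rightarrow> nat \<Rightarrow> 'a" where
  "cps_mult a b = (\<lambda>n. \<Sum>k\<le>n. a k * b (n - k))"

definition cps_star :: "(nat \<Rightarrow> 'a::cstar_algebra) \<Rightarrow> nat \<Rightarrow> 'a" where
  "cps_star a = (\<lambda>n. star (a n))"

definition cps_eval :: "(nat \<Rightarrow> 'a::cstar_algebra) \<Rightarrow> real \<Rightarrow> 'a" where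
  "cps_eval a t = (\<Sum>n. t ^ n *\<^sub>R a n)"

definition cps_norm :: "real set \<Rightarrow> (nat \<Rightarrow> 'a::cstar_algebra) \<Rightarrow> real" where
  "cps_norm K a = (SUP t\<in>K. norm (cps_eval a t))"

definition cps_map :: "('a::cstar_algebra \<Rightarrow> 'b::cstar_algebra) \<Rightarrow> (nat \<Rightarrow> 'a) \<Rightarrow> nat \<Rightarrow> 'b" where
  "cps_map f a = (\<lambda>n. f (a n))"


section \<open>The Cauchy extension\<close>

text \<open>
  The completion of \<open>A[Z]\<close> is realised as the closure of its isometric image in the
  C*-algebra of bounded functions vanishing outside \<open>K\<close>, normed by the supremum. The domain
  \<^typ>\<open>real discrete\<close> makes every function continuous, so that no condition beyond boundedness
  is imposed. That this is a completion is established below: \<open>cps_emb K\<close> is an injective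
  *-homomorphism with \<open>norm (cps_emb K a) = cps_norm K a\<close>, and \<open>cauchy_ext K A\<close> is a C*-algebra
  (in particular complete) in which its image is dense.
\<close>

definition cps_emb :: "real set \<Rightarrow> (nat \<Rightarrow> 'a::cstar_algebra) \<Rightarrow> real discrete \<Rightarrow>\<^sub>C 'a" where
  "cps_emb K a = Bcontfun (\<lambda>s. if of_discrete s \<in> K then cps_eval a (of_discrete s) else 0)"

definition cauchy_ext :: "real set \<Rightarrow> 'a::cstar_algebra set \<Rightarrow> (real discrete \<Rightarrow>\<^sub>C 'a) set" where
  "cauchy_ext K A = closure (cps_emb K ` cps A)"

text \<open>
  The induced map is the continuous extension of \<open>cps_map f\<close> along \<open>cps_emb K\<close>; it is made unique
  as a HOL function by fixing its value off \<open>cauchy_ext K A\<close>.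
\<close>

definition cauchy_map ::
  "real set \<Rightarrow> 'a::cstar_algebra set \<Rightarrow> ('a \<Rightarrow> 'b::cstar_algebra) \<Rightarrow>
    (real discrete \<Rightarrow>\<^sub>C 'a) \<Rightarrow> (real discrete \<Rightarrow>\<^sub>C 'b)" where
  "cauchy_map K A f =
     (THE h. h \<in> extensional (cauchy_ext K A) \<and>
             continuous_on (cauchy_ext K A) h \<and>
             (\<forall>a\<in>cps A. h (cps_emb K a) = cps_emb K (cps_map f a)))"


subsection \<open>The Cauchy extension is a completion\<close>

lemma cps_summable_norm:
  assumes "a \<in> cps A" and "\<bar>t\<bar> \<le> 1"
  shows "summable (\<lambda>n. norm (t ^ n *\<^sub>R a n))"
proof (rule summable_comparison_test')
  show "summable (\<lambda>n. norm (a n))" using assms by (simp add: cps_def)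
  show "norm (norm (t ^ n *\<^sub>R a n)) \<le> norm (a n)" for n
    using power_le_one[of "\<bar>t\<bar>" n] assms(2)
    by (simp add: power_abs mult_left_le_one_le)
qed

lemmas cps_summable = summable_norm_cancel[OF cps_summable_norm]

lemma cps_eval_bound:
  assumes "a \<in> cps A" and "\<bar>t\<bar> \<le> 1"
  shows "norm (cps_eval a t) \<le> (\<Sum>n. norm (a n))"
proof -
  have "norm (cps_eval a t) \<le> (\<Sum>n. norm (t ^ n *\<^sub>R a n))"
    unfolding cps_eval_def by (rule summable_norm[OF cps_summable_norm[OF assms]])
  also have "\<dots> \<le> (\<Sum>n. norm (a n))"
    using power_le_one[of "\<bar>t\<bar>"] assms
    by (intro suminf_le cps_summable_norm[OF assms])
      (simp_all add: cps_def power_abs mult_left_le_one_le)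
  finally show ?thesis .
qed

lemma apply_cps_emb:
  assumes "K \<subseteq> {-1..1}" and "a \<in> cps A"
  shows "cps_emb K a s = (if of_discrete s \<in> K then cps_eval a (of_discrete s) else 0)"
proof -
  have "(\<lambda>s. if of_discrete s \<in> K then cps_eval a (of_discrete s) else 0) \<in> bcontfun"
  proof (rule bcontfun_normI)
    show "continuous_on UNIV (\<lambda>s. if of_discrete s \<in> K then cps_eval a (of_discrete s) else 0)"
      by (auto simp: continuous_on_open_vimage open_discrete)
    have "0 \<le> (\<Sum>n. norm (a n))" using assms by (intro suminf_nonneg) (auto simp: cps_def)
    then show "norm (if of_discrete s \<in> K then cps_eval a (of_discrete s) else 0)
        \<le> (\<Sum>n. norm (a n))" for s
      using assms cps_eval_bound[of a A "of_discrete s"] by (force simp: abs_le_iff)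
  qed
  then show ?thesis by (simp add: cps_emb_def Bcontfun_inverse)
qed

lemma norm_cps_emb:
  assumes "K \<subseteq> {-1..1}" and "K \<noteq> {}" and "a \<in> cps A"
  shows "norm (cps_emb K a) = cps_norm K a"
proof (rule antisym)
  have bdd: "bdd_above ((\<lambda>t. norm (cps_eval a t)) ` K)"
    using assms cps_eval_bound[of a A] by (force intro!: bdd_aboveI2 simp: abs_le_iff)
  obtain t0 where "t0 \<in> K" using assms by auto
  then have "0 \<le> cps_norm K a"
    unfolding cps_norm_def using cSUP_upper2[OF bdd] norm_ge_zero by blast
  then show "norm (cps_emb K a) \<le> cps_norm K a"
    by (intro norm_bound)
      (auto simp: apply_cps_emb[OF assms(1,3)] cps_norm_def intro!: cSUP_upper[OF _ bdd])
  show "cps_norm K a \<le> norm (cps_emb K a)"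
    unfolding cps_norm_def
  proof (rule cSUP_least[OF assms(2)])
    fix t assume "t \<in> K"
    then show "norm (cps_eval a t) \<le> norm (cps_emb K a)"
      using norm_bounded[of "cps_emb K a" "discrete t"]
      by (simp add: apply_cps_emb[OF assms(1,3)] discrete_inverse)
  qed
qed

context
  fixes A :: "'a::cstar_algebra set"
  assumes A: "cstar A"
begin

lemma cps_add_closed: "a \<in> cps A \<Longrightarrow> b \<in> cps A \<Longrightarrow> cps_add a b \<in> cps A"
  using A by (auto simp: cps_def cps_add_def cstar_def norm_triangle_ineq
      intro!: summable_comparison_test'[OF summable_add, of "\<lambda>n. norm (a n)" "\<lambda>n. norm (b n)"])

lemma cps_scale_closed: "a \<in> cps A \<Longrightarrow> cps_scale c a \<in> cps A"
  using A by (auto simp: cps_def cps_scale_def cstar_def norm_scaleC intro!: summable_mult)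

lemma cps_star_closed: "a \<in> cps A \<Longrightarrow> cps_star a \<in> cps A"
  using A by (auto simp: cps_def cps_star_def cstar_def norm_star)

lemma cps_mult_closed:
  assumes "a \<in> cps A" and "b \<in> cps A"
  shows "cps_mult a b \<in> cps A"
proof -
  have sum: "(\<Sum>k\<in>I. h k) \<in> A" if "finite I" "\<And>k. h k \<in> A" for I :: "nat set" and h
    using that(1) by induction (use A that(2) in \<open>auto simp: cstar_def\<close>)
  have "summable (\<lambda>n. \<Sum>k\<le>n. norm (a k) * norm (b (n - k)))"
    using assms by (intro summable_Cauchy_product) (auto simp: cps_def)
  then have "summable (\<lambda>n. norm (cps_mult a b n))"
    by (rule summable_comparison_test')
      (auto simp: cps_mult_def intro!: order.trans[OF norm_sum] sum_mono norm_mult_ineq)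
  moreover have "cps_mult a b n \<in> A" for n
    using assms A unfolding cps_mult_def by (intro sum) (auto simp: cps_def cstar_def)
  ultimately show ?thesis by (simp add: cps_def)
qed

lemma cps_eval_add:
  assumes "a \<in> cps A" "b \<in> cps A" "\<bar>t\<bar> \<le> 1"
  shows "cps_eval (cps_add a b) t = cps_eval a t + cps_eval b t"
  using suminf_add[OF cps_summable[OF assms(1,3)] cps_summable[OF assms(2,3)]]
  by (simp add: cps_eval_def cps_add_def scaleR_right_distrib)

lemma cps_eval_scale:
  assumes "a \<in> cps A" "\<bar>t\<bar> \<le> 1"
  shows "cps_eval (cps_scale c a) t = c *\<^sub>C cps_eval a t"
  using bounded_linear.suminf[OF bounded_linear_scaleC cps_summable[OF assms], of c]
  by (simp add: cps_eval_def cps_scale_def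
      linear_scale[OF bounded_linear.linear[OF bounded_linear_scaleC]])

lemma cps_eval_star:
  assumes "a \<in> cps A" "\<bar>t\<bar> \<le> 1"
  shows "cps_eval (cps_star a) t = star (cps_eval a t)"
  using bounded_linear.suminf[OF bounded_linear_star cps_summable[OF assms]]
  by (simp add: cps_eval_def cps_star_def
      linear_scale[OF bounded_linear.linear[OF bounded_linear_star]])

lemma cps_eval_mult:
  assumes "a \<in> cps A" "b \<in> cps A" "\<bar>t\<bar> \<le> 1"
  shows "cps_eval (cps_mult a b) t = cps_eval a t * cps_eval b t"
proof -
  have "cps_eval a t * cps_eval b t
      = (\<Sum>n. \<Sum>k\<le>n. (t ^ k *\<^sub>R a k) * (t ^ (n - k) *\<^sub>R b (n - k)))"
    unfolding cps_eval_def by (intro Cauchy_product cps_summable_norm[of _ A] assms)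
  also have "\<dots> = cps_eval (cps_mult a b) t"
    unfolding cps_eval_def cps_mult_def
    by (intro suminf_cong) (auto simp: scaleR_sum_right power_add[symmetric] intro!: sum.cong)
  finally show ?thesis by simp
qed

lemma cps_emb_hom:
  assumes K: "K \<subseteq> {-1..1}" and "a \<in> cps A" and "b \<in> cps A"
  shows "cps_emb K (cps_add a b) = cps_emb K a + cps_emb K b"
    and "cps_emb K (cps_mult a b) = cps_emb K a * cps_emb K b"
    and "cps_emb K (cps_scale c a) = c *\<^sub>C cps_emb K a"
    and "cps_emb K (cps_star a) = star (cps_emb K a)"
proof -
  have t: "\<bar>t\<bar> \<le> 1" if "t \<in> K" for t using K that by (auto simp: abs_le_iff)
  have z: "c *\<^sub>C 0 = (0::'a)" "star 0 = (0::'a)"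
    by (simp_all add: linear_0 bounded_linear.linear bounded_linear_scaleC bounded_linear_star)
  note * = apply_cps_emb[OF K, of _ A] cps_add_closed cps_mult_closed cps_scale_closed cps_star_closed
    cps_eval_add cps_eval_mult cps_eval_scale cps_eval_star t z assms(2,3)
  show "cps_emb K (cps_add a b) = cps_emb K a + cps_emb K b"
    and "cps_emb K (cps_mult a b) = cps_emb K a * cps_emb K b"
    and "cps_emb K (cps_scale c a) = c *\<^sub>C cps_emb K a"
    and "cps_emb K (cps_star a) = star (cps_emb K a)"
    by (rule bcontfun_eqI, simp add: *)+
qed

lemma cps_coeff_zero:
  assumes K: "K \<subseteq> {-1..1}" "0 islimpt K" and a: "a \<in> cps A"
    and zero: "\<And>t. t \<in> K \<Longrightarrow> cps_eval a t = 0"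
  shows "a n = 0"
proof (induction n rule: less_induct)
  case (less n)
  define b where "b k = a (k + n)" for k
  have b: "b \<in> cps A"
    using a summable_iff_shift[of "\<lambda>k. norm (a k)" n] by (auto simp: cps_def b_def)
  define S where "S = (\<Sum>k. norm (b (Suc k)))"
  have sS: "summable (\<lambda>k. norm (b (Suc k)))"
    using b summable_Suc_iff[of "\<lambda>k. norm (b k)"] by (simp add: cps_def)
  have bt: "norm (b 0) \<le> \<bar>t\<bar> * S" if t: "t \<in> K" "t \<noteq> 0" for t
  proof -
    have t1: "\<bar>t\<bar> \<le> 1" using K t by (auto simp: abs_le_iff)
    have "0 = (\<Sum>k. t ^ k *\<^sub>R a k)" using zero[OF t(1)] by (simp add: cps_eval_def)
    also have "\<dots> = (\<Sum>k. t ^ (k + n) *\<^sub>R a (k + n))"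
      using suminf_split_initial_segment[OF cps_summable[OF a t1], of n] less by simp
    also have "\<dots> = (\<Sum>k. t ^ n *\<^sub>R (t ^ k *\<^sub>R b k))"
      by (simp add: b_def power_add mult.commute)
    also have "\<dots> = t ^ n *\<^sub>R (\<Sum>k. t ^ k *\<^sub>R b k)"
      by (rule suminf_scaleR_right[OF cps_summable[OF b t1], symmetric])
    finally have "(\<Sum>k. t ^ k *\<^sub>R b k) = 0" using t by simp
    then have "b 0 = - (\<Sum>k. t ^ Suc k *\<^sub>R b (Suc k))"
      using suminf_split_head[OF cps_summable[OF b t1]] by simp
    then have "norm (b 0) = norm (\<Sum>k. t ^ Suc k *\<^sub>R b (Suc k))" by simp
    also have "\<dots> \<le> (\<Sum>k. norm (t ^ Suc k *\<^sub>R b (Suc k)))"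
      using cps_summable_norm[OF b t1]
      by (intro summable_norm) (subst summable_Suc_iff, assumption)
    also have "\<dots> \<le> (\<Sum>k. \<bar>t\<bar> * norm (b (Suc k)))"
    proof (rule suminf_le)
      show "norm (t ^ Suc k *\<^sub>R b (Suc k)) \<le> \<bar>t\<bar> * norm (b (Suc k))" for k
        using power_le_one[of "\<bar>t\<bar>" k] t1
        by (simp add: power_abs abs_mult mult.assoc mult_left_le_one_le mult_left_mono)
      show "summable (\<lambda>k. norm (t ^ Suc k *\<^sub>R b (Suc k)))"
        using cps_summable_norm[OF b t1] by (subst summable_Suc_iff)
    qed (intro summable_mult sS)
    also have "\<dots> = \<bar>t\<bar> * S" using suminf_mult[OF sS] by (simp add: S_def)
    finally show ?thesis .
  qed
  have "b 0 = 0"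
  proof (rule ccontr)
    assume "b 0 \<noteq> 0"
    have "S \<ge> 0" unfolding S_def by (intro suminf_nonneg sS) simp
    define e where "e = norm (b 0) / (S + 1)"
    have "e > 0" using \<open>b 0 \<noteq> 0\<close> \<open>S \<ge> 0\<close> by (simp add: e_def)
    then obtain t where t: "t \<in> K" "t \<noteq> 0" "\<bar>t\<bar> < e"
      using K(2) by (auto simp: islimpt_approachable)
    have "\<bar>t\<bar> * S \<le> \<bar>t\<bar> * (S + 1)" by (simp add: mult_left_mono)
    also have "\<dots> < e * (S + 1)" using t \<open>S \<ge> 0\<close> by (intro mult_strict_right_mono) auto
    also have "\<dots> = norm (b 0)" using \<open>S \<ge> 0\<close> by (simp add: e_def)
    finally show False using bt[OF t(1,2)] by simp
  qed
  then show ?case by (simp add: b_def)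
qed

lemma inj_on_cps_emb:
  assumes K: "K \<subseteq> {-1..1}" "0 islimpt K"
  shows "inj_on (cps_emb K) (cps A)"
proof (rule inj_onI)
  fix a b assume a: "a \<in> cps A" and b: "b \<in> cps A" and eq: "cps_emb K a = cps_emb K b"
  define d where "d = cps_add a (cps_scale (- 1) b)"
  have m: "(- 1) *\<^sub>C x = - x" for x :: 'a
    using scaleC_of_real[of "- 1" x] by simp
  have d: "d \<in> cps A" by (simp add: d_def cps_add_closed cps_scale_closed a b)
  have "cps_eval d t = 0" if t: "t \<in> K" for t
  proof -
    have "cps_eval a t = cps_eval b t"
      using arg_cong[OF eq, of "\<lambda>h. apply_bcontfun h (discrete t)"] t
      by (simp add: apply_cps_emb[OF K(1) a] apply_cps_emb[OF K(1) b] discrete_inverse)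
    moreover have "\<bar>t\<bar> \<le> 1" using K t by (auto simp: abs_le_iff)
    ultimately show ?thesis
      by (simp add: d_def cps_eval_add cps_eval_scale cps_scale_closed a b m)
  qed
  then have "d n = 0" for n by (rule cps_coeff_zero[OF K d])
  then show "a = b" by (auto simp: d_def cps_add_def cps_scale_def m)
qed

lemma cstar_cauchy_ext:
  assumes K: "K \<subseteq> {-1..1}"
  shows "cstar (cauchy_ext K A)"
proof -
  let ?S = "cps_emb K ` cps A"
  have un: "h x \<in> closure ?S"
    if "x \<in> closure ?S" "continuous_on UNIV h" "\<And>y. y \<in> ?S \<Longrightarrow> h y \<in> ?S"
    for h :: "(real discrete \<Rightarrow>\<^sub>C 'a) \<Rightarrow> real discrete \<Rightarrow>\<^sub>C 'a" and x
  proof -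
    have "h ` closure ?S \<subseteq> closure ?S"
      using that(3) closure_subset[of ?S]
      by (intro image_closure_subset continuous_on_subset[OF that(2)]) auto
    with that(1) show ?thesis by auto
  qed
  have bin: "h (x, y) \<in> closure ?S"
    if "x \<in> closure ?S" "y \<in> closure ?S" "continuous_on UNIV h"
      "\<And>x y. x \<in> ?S \<Longrightarrow> y \<in> ?S \<Longrightarrow> h (x, y) \<in> ?S"
    for h :: "(real discrete \<Rightarrow>\<^sub>C 'a) \<times> (real discrete \<Rightarrow>\<^sub>C 'a) \<Rightarrow> real discrete \<Rightarrow>\<^sub>C 'a" and x y
  proof -
    have "h ` closure (?S \<times> ?S) \<subseteq> closure ?S"
      using that(4) closure_subset[of ?S]
      by (intro image_closure_subset continuous_on_subset[OF that(3)]) auto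
    with that(1,2) show ?thesis by (auto simp: closure_Times)
  qed
  have ne: "(\<lambda>_. 0) \<in> cps A" using A by (auto simp: cps_def cstar_def)
  have "cps_emb K (\<lambda>_. 0) = (0 :: real discrete \<Rightarrow>\<^sub>C 'a)"
    by (rule bcontfun_eqI) (simp add: apply_cps_emb[OF K ne] cps_eval_def)
  then have "0 \<in> closure ?S"
    using ne closure_subset[of ?S] by (metis image_eqI subsetD)
  moreover have "x + y \<in> closure ?S" if "x \<in> closure ?S" "y \<in> closure ?S" for x y
    using bin[OF that, of "\<lambda>p. fst p + snd p"]
    by (force intro!: continuous_intros simp: cps_emb_hom(1)[OF K, symmetric] cps_add_closed)
  moreover have "x * y \<in> closure ?S" if "x \<in> closure ?S" "y \<in> closure ?S" for x y
    using bin[OF that, of "\<lambda>p. fst p * snd p"]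
    by (force intro!: continuous_intros simp: cps_emb_hom(2)[OF K, symmetric] cps_mult_closed)
  moreover have "c *\<^sub>C x \<in> closure ?S" if "x \<in> closure ?S" for x c
    using un[OF that, of "scaleC c"]
    by (force intro!: linear_continuous_on bounded_linear_scaleC
        simp: cps_emb_hom(3)[OF K, symmetric] cps_scale_closed)
  moreover have "star x \<in> closure ?S" if "x \<in> closure ?S" for x
    using un[OF that, of star]
    by (force intro!: linear_continuous_on bounded_linear_star
        simp: cps_emb_hom(4)[OF K, symmetric] cps_star_closed)
  ultimately show ?thesis by (simp add: cstar_def cauchy_ext_def)
qed

end


subsection \<open>The induced map is the continuous extension\<close>

text \<open>
  Contractivity of \<open>f\<close> is automatic for *-homomorphisms between C*-algebras; here it is a
  hypothesis.
\<close>

lemma cps_map_closed: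
  assumes "star_hom A B f" and "\<And>x. x \<in> A \<Longrightarrow> norm (f x) \<le> norm x" and "a \<in> cps A"
  shows "cps_map f a \<in> cps B"
  using assms
  by (auto simp: cps_def cps_map_def star_hom_def
      intro!: summable_comparison_test'[of "\<lambda>n. norm (a n)" 0])

lemma cps_eval_map:
  assumes A: "cstar A" and f: "star_hom A B f" and le: "\<And>x. x \<in> A \<Longrightarrow> norm (f x) \<le> norm x"
    and a: "a \<in> cps A" and t: "\<bar>t\<bar> \<le> 1"
  shows "cps_eval a t \<in> A" and "cps_eval (cps_map f a) t = f (cps_eval a t)"
proof -
  have sc: "r *\<^sub>R x \<in> A" "f (r *\<^sub>R x) = r *\<^sub>R f x" if "x \<in> A" for r x
  proof -
    have "complex_of_real r *\<^sub>C x \<in> A"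
      and "f (complex_of_real r *\<^sub>C x) = complex_of_real r *\<^sub>C f x"
      using A f that unfolding cstar_def star_hom_def by blast+
    then show "r *\<^sub>R x \<in> A" "f (r *\<^sub>R x) = r *\<^sub>R f x" by (simp_all add: scaleC_of_real)
  qed
  have f0: "f 0 = 0" using sc[of 0 0] A by (simp add: cstar_def)
  have diff: "x - y \<in> A" "f (x - y) = f x - f y" if "x \<in> A" "y \<in> A" for x y
  proof -
    have "x + (- 1) *\<^sub>R y \<in> A" "f (x + (- 1) *\<^sub>R y) = f x + f ((- 1) *\<^sub>R y)"
      using A f that sc(1)[of y "- 1"] by (auto simp: cstar_def star_hom_def)
    then show "x - y \<in> A" "f (x - y) = f x - f y"
      using sc(2)[OF that(2), of "- 1"] by simp_all
  qed
  let ?s = "\<lambda>n. \<Sum>k<n. t ^ k *\<^sub>R a k"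
  have aA: "a k \<in> A" for k using a by (simp add: cps_def)
  have sA: "?s n \<in> A \<and> f (?s n) = (\<Sum>k<n. t ^ k *\<^sub>R cps_map f a k)" for n
  proof (induction n)
    case 0
    then show ?case using A f0 by (simp add: cstar_def)
  next
    case (Suc n)
    have "t ^ n *\<^sub>R a n \<in> A" using sc aA by simp
    with Suc show ?case
      using A f sc(2)[OF aA] by (simp add: cstar_def star_hom_def cps_map_def)
  qed
  have lim: "?s \<longlonglongrightarrow> cps_eval a t"
    unfolding cps_eval_def by (rule summable_LIMSEQ[OF cps_summable[OF a t]])
  then show eA: "cps_eval a t \<in> A"
    using closed_sequentially[of A ?s, OF _ _ lim] A sA unfolding cstar_def by blast
  have "(\<lambda>n. f (?s n)) \<longlonglongrightarrow> f (cps_eval a t)"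
  proof (rule metric_tendsto_imp_tendsto[OF lim])
    show "\<forall>\<^sub>F n in sequentially. dist (f (?s n)) (f (cps_eval a t)) \<le> dist (?s n) (cps_eval a t)"
    proof (intro always_eventually allI)
      fix n
      have "?s n \<in> A" using sA by simp
      note d = diff[OF this eA]
      show "dist (f (?s n)) (f (cps_eval a t)) \<le> dist (?s n) (cps_eval a t)"
        unfolding dist_norm d(2)[symmetric] by (rule le[OF d(1)])
    qed
  qed
  moreover have "(\<lambda>n. f (?s n)) \<longlonglongrightarrow> cps_eval (cps_map f a) t"
    using sA summable_LIMSEQ[OF cps_summable[OF cps_map_closed[OF f le a] t]]
    by (simp add: cps_eval_def)
  ultimately show "cps_eval (cps_map f a) t = f (cps_eval a t)"
    by (rule LIMSEQ_unique[symmetric])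
qed

lemma cps_emb_map_dist:
  assumes K: "K \<subseteq> {-1..1}" and A: "cstar A" and f: "star_hom A B f"
    and le: "\<And>x. x \<in> A \<Longrightarrow> norm (f x) \<le> norm x"
    and a: "a \<in> cps A" and b: "b \<in> cps A"
  shows "dist (cps_emb K (cps_map f a)) (cps_emb K (cps_map f b)) \<le> dist (cps_emb K a) (cps_emb K b)"
proof (rule dist_bound)
  fix s
  have diff: "x - y \<in> A" "f (x - y) = f x - f y" if "x \<in> A" "y \<in> A" for x y
  proof -
    have m: "(- 1) *\<^sub>C z = - z" for z :: "'c::cstar_algebra"
      using scaleC_of_real[of "- 1" z] by simp
    have "(- 1) *\<^sub>C y \<in> A" "f ((- 1) *\<^sub>C y) = (- 1) *\<^sub>C f y"
      using A f that by (auto simp: cstar_def star_hom_def)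
    then have "- y \<in> A" "f (- y) = - f y" by (simp_all add: m)
    then have "x + - y \<in> A" "f (x + - y) = f x + - f y"
      using A f that by (auto simp: cstar_def star_hom_def simp del: add_uminus_conv_diff)
    then show "x - y \<in> A" "f (x - y) = f x - f y" by simp_all
  qed
  note ab = apply_cps_emb[OF K a] apply_cps_emb[OF K b]
    apply_cps_emb[OF K cps_map_closed[OF f le a]] apply_cps_emb[OF K cps_map_closed[OF f le b]]
  have "dist (cps_emb K (cps_map f a) s) (cps_emb K (cps_map f b) s)
      \<le> dist (cps_emb K a s) (cps_emb K b s)"
  proof (cases "of_discrete s \<in> K")
    case True
    then have t: "\<bar>of_discrete s\<bar> \<le> 1" using K by (auto simp: abs_le_iff)
    note ev = cps_eval_map[OF A f le a t] cps_eval_map[OF A f le b t]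
    show ?thesis
      using True ev le[OF diff(1)[OF ev(1,3)]] by (simp add: ab dist_norm diff(2))
  qed (simp add: ab)
  also have "\<dots> \<le> dist (cps_emb K a) (cps_emb K b)" by (rule dist_bounded)
  finally show "dist (cps_emb K (cps_map f a) s) (cps_emb K (cps_map f b) s)
      \<le> dist (cps_emb K a) (cps_emb K b)" .
qed

lemma cauchy_map_extends:
  assumes K: "K \<subseteq> {-1..1}" and A: "cstar A" and f: "star_hom A B f"
    and le: "\<And>x. x \<in> A \<Longrightarrow> norm (f x) \<le> norm x"
  shows "continuous_on (cauchy_ext K A) (cauchy_map K A f)"
    and "a \<in> cps A \<Longrightarrow> cauchy_map K A f (cps_emb K a) = cps_emb K (cps_map f a)"
proof -
  let ?X = "cauchy_ext K A" and ?S = "cps_emb K ` cps A"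
  let ?P = "\<lambda>h. h \<in> extensional ?X \<and> continuous_on ?X h \<and>
             (\<forall>a\<in>cps A. h (cps_emb K a) = cps_emb K (cps_map f a))"
  define h0 where "h0 x = cps_emb K (cps_map f (SOME a. a \<in> cps A \<and> cps_emb K a = x))" for x
  have h0: "h0 (cps_emb K a) = cps_emb K (cps_map f a)" if a: "a \<in> cps A" for a
  proof -
    define b where "b = (SOME b. b \<in> cps A \<and> cps_emb K b = cps_emb K a)"
    have "b \<in> cps A \<and> cps_emb K b = cps_emb K a"
      unfolding b_def by (rule someI[of _ a]) (simp add: a)
    then show ?thesis
      using cps_emb_map_dist[OF K A f le, of b a] a by (simp add: h0_def b_def)
  qed
  have "uniformly_continuous_on ?S h0"
    unfolding uniformly_continuous_on_def
  proof (intro allI impI)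
    fix e :: real assume "e > 0"
    have "dist (h0 y) (h0 x) < e" if "x \<in> ?S" "y \<in> ?S" "dist y x < e" for x y
    proof -
      obtain a b where "x = cps_emb K a" "y = cps_emb K b" "a \<in> cps A" "b \<in> cps A"
        using \<open>x \<in> ?S\<close> \<open>y \<in> ?S\<close> by auto
      then show ?thesis
        using cps_emb_map_dist[OF K A f le, of b a] that(3) by (simp add: h0)
    qed
    with \<open>e > 0\<close> show "\<exists>d>0. \<forall>x\<in>?S. \<forall>y\<in>?S. dist y x < d \<longrightarrow> dist (h0 y) (h0 x) < e"
      by blast
  qed
  then obtain h1 where h1: "uniformly_continuous_on (closure ?S) h1" "\<And>x. x \<in> ?S \<Longrightarrow> h0 x = h1 x"
    by (rule uniformly_continuous_on_extension_on_closure) blast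
  have S: "?S \<subseteq> ?X" by (simp add: cauchy_ext_def closure_subset)
  have "continuous_on ?X h1"
    using h1(1) by (simp add: cauchy_ext_def uniformly_continuous_imp_continuous)
  then have "continuous_on ?X (restrict h1 ?X)"
    by (simp cong: continuous_on_cong)
  moreover have "restrict h1 ?X (cps_emb K a) = cps_emb K (cps_map f a)" if "a \<in> cps A" for a
    using h1(2)[of "cps_emb K a"] h0 S that by (auto simp: restrict_def)
  ultimately have ex: "?P (restrict h1 ?X)" by simp
  have uniq: "h = h'" if "?P h" "?P h'" for h h'
  proof (rule extensionalityI[of _ ?X])
    fix x assume x: "x \<in> ?X"
    have "continuous_on (closure ?S) (\<lambda>x. h x - h' x)"
      using that by (intro continuous_intros) (auto simp: cauchy_ext_def)
    then have "h x - h' x = 0"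
    proof (rule continuous_constant_on_closure)
      show "h y - h' y = 0" if "y \<in> ?S" for y
        using that \<open>?P h\<close> \<open>?P h'\<close> by auto
      show "x \<in> closure ?S" using x by (simp add: cauchy_ext_def)
    qed
    then show "h x = h' x" by simp
  qed (use that in auto)
  have "?P (cauchy_map K A f)"
    unfolding cauchy_map_def by (rule theI[of ?P, OF ex]) (rule uniq[OF _ ex])
  then show "continuous_on ?X (cauchy_map K A f)"
    and "a \<in> cps A \<Longrightarrow> cauchy_map K A f (cps_emb K a) = cps_emb K (cps_map f a)"
    by auto
qed

end

(*
  A function in [A]_K is a uniform limit of functions that are uniformly continuous on K;
  conversely, partitions of unity and the Weierstrass theorem put every uniformly continuous
  A-valued function on K into [A]_K, and the induced maps act on such functions by composition.
  Exactness is thus a lifting problem for functions. In the middle, f has a bounded inverse on its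
  closed range by the open mapping theorem, so composing with the inverse preserves uniform
  continuity. On the right, a function is approximated by combinations of finitely many of its
  values through a partition of unity; lifting these values with a norm bound and iterating on the
  remainder gives an exact lift.
*)

theory Submission
  imports Defs
begin

section \<open>Contractivity of *-homomorphisms\<close>

lemma star_0 [simp]: "star (0::'a::cstar_algebra) = 0"
  by (simp add: linear_0 bounded_linear.linear bounded_linear_star)

lemma star_scaleR: "star (r *\<^sub>R x) = r *\<^sub>R star x" for x :: "'a::cstar_algebra"
  by (simp add: linear_cmul bounded_linear.linear bounded_linear_star)

lemma scaleC_diff_right: "c *\<^sub>C (x - y) = c *\<^sub>C x - c *\<^sub>C y" for x y :: "'a::cstar_algebra"
  by (simp add: linear_diff bounded_linear.linear bounded_linear_scaleC)

lemma scaleC_minus1: "(- 1) *\<^sub>C x = - x" for x :: "'a::cstar_algebra"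
  using scaleC_of_real[of "- 1" x] by simp

lemma cstar_subspace:
  assumes "cstar A"
  shows "subspace A"
proof (rule subspaceI)
  show "c *\<^sub>R x \<in> A" if "x \<in> A" for c x
    using assms that unfolding cstar_def by (metis scaleC_of_real)
qed (use assms in \<open>auto simp: cstar_def\<close>)

lemma cstarD:
  assumes "cstar A"
  shows "closed A" "0 \<in> A" "x \<in> A \<Longrightarrow> y \<in> A \<Longrightarrow> x * y \<in> A"
    "x \<in> A \<Longrightarrow> c *\<^sub>C x \<in> A" "x \<in> A \<Longrightarrow> star x \<in> A"
    "x \<in> A \<Longrightarrow> y \<in> A \<Longrightarrow> x + y \<in> A" "x \<in> A \<Longrightarrow> y \<in> A \<Longrightarrow> x - y \<in> A" "x \<in> A \<Longrightarrow> r *\<^sub>R x \<in> A"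
  using assms subspace_diff[OF cstar_subspace[OF assms]]
    subspace_scale[OF cstar_subspace[OF assms]]
  by (auto simp: cstar_def)

lemma star_homD:
  assumes "star_hom A B f" and "x \<in> A"
  shows "f x \<in> B" "y \<in> A \<Longrightarrow> f (x + y) = f x + f y" "y \<in> A \<Longrightarrow> f (x * y) = f x * f y"
    "f (c *\<^sub>C x) = c *\<^sub>C f x" "f (star x) = star (f x)" "f (r *\<^sub>R x) = r *\<^sub>R f x"
proof -
  show "f (r *\<^sub>R x) = r *\<^sub>R f x"
    using assms unfolding star_hom_def by (metis scaleC_of_real)
qed (use assms in \<open>auto simp: star_hom_def\<close>)

lemma star_hom_0:
  assumes "cstar A" "star_hom A B f"
  shows "f 0 = 0"
  using star_homD(6)[OF assms(2) cstarD(2)[OF assms(1)], of 0] by simp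

lemma star_hom_diff:
  assumes "cstar A" "star_hom A B f" "x \<in> A" "y \<in> A"
  shows "f (x - y) = f x - f y"
  using star_homD(2)[OF assms(2) cstarD(7)[OF assms(1,3,4)] assms(4)] by simp

text \<open>
  A contraction argument replaces the functional calculus: \<open>v\<close> stands for \<open>1 - sqrt (1 - h\<^sup>2)\<close>.
\<close>

lemma ex_sqrt_defect:
  assumes A: "cstar A" and h: "h \<in> A" "star h = h" "norm h \<le> 1 / 2"
  obtains v where "v \<in> A" "star v = v" "v * h = h * v" "h * h + v * v = 2 *\<^sub>R v"
proof -
  \<comment> \<open>The ball of radius 1/2 makes \<open>?T\<close> both a self-map and a contraction
    with factor 1/2. The other conditions are closed and preserved by \<open>?T\<close>, so the
    fixed point inherits them.\<close>
  let ?S = "A \<inter> {v. star v = v} \<inter> {v. v * h = h * v} \<inter> cball 0 (1 / 2)"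
  let ?T = "\<lambda>v. (1 / 2) *\<^sub>R (h * h + v * v)"
  have cs: "continuous_on UNIV (star :: 'a \<Rightarrow> 'a)"
    by (rule linear_continuous_on[OF bounded_linear_star])
  have nsq: "norm (x * x) \<le> 1 / 4" if "norm x \<le> 1 / 2" for x :: 'a
    using norm_mult_ineq[of x x] mult_mono[OF that that] by simp
  have "\<exists>!v\<in>?S. ?T v = v"
  proof (rule Banach_fix)
    have "closed {v. star v = (v::'a)}" "closed {v. v * h = h * v}"
      by (rule closed_Collect_eq; intro cs continuous_intros)+
    then show "complete ?S"
      by (simp add: complete_eq_closed closed_Int cstarD(1)[OF A])
    show "?S \<noteq> {}" using cstarD(2)[OF A] by auto
    show "?T ` ?S \<subseteq> ?S"
    proof safe
      fix v assume v: "v \<in> A" "star v = v" "v * h = h * v" "v \<in> cball 0 (1 / 2)"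
      show "?T v \<in> A" using v h by (intro cstarD[OF A])
      show "star (?T v) = ?T v" using v h by (simp add: star_scaleR star_add star_mult)
      have "(v * v) * h = h * (v * v)" by (metis mult.assoc v(3))
      then show "?T v * h = h * ?T v" by (simp add: algebra_simps)
      have "norm (h * h + v * v) \<le> 1 / 4 + 1 / 4"
        using h v by (intro norm_triangle_mono nsq) auto
      then show "?T v \<in> cball 0 (1 / 2)" by simp
    qed
    fix x y assume xy: "x \<in> ?S" "y \<in> ?S"
    \<comment> \<open>Elements \<open>x\<close> and \<open>y\<close> of \<open>?S\<close> need not
      commute, so the difference of squares is split in this asymmetric way.\<close>
    have "?T x - ?T y = (1 / 2) *\<^sub>R (x * (x - y) + (x - y) * y)"
      by (simp add: algebra_simps)
    then have "norm (?T x - ?T y) = (1 / 2) * norm (x * (x - y) + (x - y) * y)" by simp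
    also have "\<dots> \<le> (1 / 2) * (norm x * norm (x - y) + norm (x - y) * norm y)"
      by (intro mult_left_mono norm_triangle_mono norm_mult_ineq) auto
    also have "\<dots> \<le> (1 / 2) * ((1 / 2) * norm (x - y) + norm (x - y) * (1 / 2))"
      using xy by (intro mult_left_mono add_mono mult_right_mono) auto
    finally show "dist (?T x) (?T y) \<le> (1 / 2) * dist x y" by (simp add: dist_norm)
  qed auto
  then obtain v where v: "v \<in> ?S" "?T v = v" by auto
  then have "h * h + v * v = 2 *\<^sub>R v"
    by (metis (no_types, lifting) scaleR_half_double scaleR_2 scaleR_right_distrib)
  with v that show thesis by auto
qed

text \<open>For self-adjoint \<open>y\<close> the C*-identity reads
  \<open>norm (y * y) = (norm y)^2\<close>, and \<open>y * y\<close> is again self-adjoint. Repeated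
  squaring will remove the constant from a crude norm bound.\<close>

lemma norm_iterated_square:
  fixes x :: "'a::cstar_algebra"
  assumes "star x = x"
  shows "norm (((\<lambda>y. y * y) ^^ n) x) = norm x ^ 2 ^ n"
    and "star (((\<lambda>y. y * y) ^^ n) x) = ((\<lambda>y. y * y) ^^ n) x"
proof (induction n)
  case (Suc n)
  let ?y = "((\<lambda>y. y * y) ^^ n) x"
  { case 1 show ?case
      using norm_star_mult_self[of ?y] Suc by (simp add: power_mult[symmetric] mult.commute) }
  { case 2 show ?case using Suc by (simp add: star_mult) }
qed (use assms in auto)

text \<open>
  With \<open>v\<close> as above, \<open>1 - v - \<i> h\<close> is a unitary of the unitization. So is the image of this
  element, which bounds its imaginary part \<open>f h\<close>.
\<close>

lemma star_hom_bound_small: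
  assumes A: "cstar A" and f: "star_hom A B f"
    and h: "h \<in> A" "star h = h" "norm h \<le> 1 / 2"
  shows "norm (f h) \<le> 2"
proof -
  obtain v where v: "v \<in> A" "star v = v" "v * h = h * v" "h * h + v * v = 2 *\<^sub>R v"
    using ex_sqrt_defect[OF A h] .
  \<comment> \<open>Here \<open>w\<close> is one minus the unitary \<open>u\<close>. Expanding
    \<open>star u * u = 1\<close> turns unitarity into \<open>star w * w = star w + w\<close>, an
    identity without a unit that \<open>f\<close> can transport.\<close>
  define w where "w = v + \<i> *\<^sub>C h"
  have ih: "\<i> *\<^sub>C h \<in> A" using h by (intro cstarD[OF A])
  have w: "w \<in> A" unfolding w_def using v ih by (intro cstarD(6)[OF A])
  have sw: "star w = v - \<i> *\<^sub>C h"
    using scaleC_scaleC[of "- 1" "\<i>" h] v h by (simp add: w_def star_add star_scaleC scaleC_minus1)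
  have "\<i> *\<^sub>C \<i> *\<^sub>C (h * h) = - (h * h)" by (simp add: scaleC_scaleC scaleC_minus1)
  then have "star w * w = h * h + v * v"
    unfolding sw by (simp add: w_def algebra_simps mult_scaleC_left mult_scaleC_right v(3)
        scaleC_diff_right)
  also have "\<dots> = star w + w" unfolding sw v(4) by (simp add: w_def scaleR_2)
  finally have eq: "star w * w = star w + w" .
  have "star (f w) * f w = star (f w) + f w"
    using arg_cong[OF eq, of f] w cstarD(5)[OF A w] by (simp add: star_homD[OF f])
  then have "(norm (f w))\<^sup>2 \<le> norm (f w) + norm (f w)"
    using norm_star_mult_self[of "f w"] norm_triangle_ineq[of "star (f w)" "f w"]
    by (simp add: norm_star)
  then have n: "norm (f w) \<le> 2"
    by (cases "f w = 0") (simp_all add: power2_eq_square field_simps)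
  have "(2 * \<i>) *\<^sub>C h = w - star w"
    using scaleC_add_left[of "\<i>" "\<i>" h] unfolding sw by (simp add: w_def)
  then have "(2 * \<i>) *\<^sub>C f h = f w - star (f w)"
    using star_homD(4)[OF f h(1), of "2 * \<i>"] star_hom_diff[OF A f w cstarD(5)[OF A w]]
    by (simp add: star_homD[OF f w])
  then have "2 * norm (f h) = norm (f w - star (f w))"
    using norm_scaleC[of "2 * \<i>" "f h"] by (simp add: norm_mult)
  also have "\<dots> \<le> norm (f w) + norm (f w)"
    using norm_triangle_ineq4[of "f w" "star (f w)"] by (simp add: norm_star)
  finally show ?thesis using n by simp
qed

text \<open>Scaling the bound for small elements gives constant 4 on self-adjoint elements. Applying
  that to iterated squares lowers the constant to 1, and the C*-identity for
  \<open>star x * x\<close> extends the result to all \<open>x\<close>.\<close>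

theorem star_hom_contractive:
  assumes A: "cstar A" and f: "star_hom A B f" and x: "x \<in> A"
  shows "norm (f x) \<le> norm x"
proof -
  have four: "norm (f h) \<le> 4 * norm h" if h: "h \<in> A" "star h = h" for h
  proof (cases "h = 0")
    case False
    \<comment> \<open>Rescaling to norm exactly 1/2 makes the bound 2 into
      \<open>4 * norm h\<close>.\<close>
    let ?r = "1 / (2 * norm h)"
    have "norm (f (?r *\<^sub>R h)) \<le> 2"
      using False h by (intro star_hom_bound_small[OF A f] cstarD[OF A]) (auto simp: star_scaleR)
    then show ?thesis using False by (simp add: star_homD[OF f h(1)] field_simps)
  qed (simp add: star_hom_0[OF A f])
  have sa: "norm (f h) \<le> norm h" if h: "h \<in> A" "star h = h" for h
  proof (rule ccontr)
    assume gt: "\<not> norm (f h) \<le> norm h"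
    let ?p = "\<lambda>n. (\<lambda>y. y * y) ^^ n"
    have fp: "?p n h \<in> A \<and> f (?p n h) = ?p n (f h)" for n
      by (induction n) (use h in \<open>auto simp: star_homD[OF f] cstarD[OF A]\<close>)
    have "star (f h) = f h" using star_homD(5)[OF f h(1)] h(2) by simp
    note p = norm_iterated_square[OF this] norm_iterated_square[OF h(2)]
    have le: "norm (f h) ^ 2 ^ n \<le> 4 * norm h ^ 2 ^ n" for n
      using four[of "?p n h"] fp[of n] p by simp
    have "norm h \<noteq> 0" using le[of 0] gt by auto
    then have pos: "norm h > 0" by simp
    have "norm (f h) / norm h > 1" using gt pos by simp
    \<comment> \<open>The ratio exceeds 1, so its powers outgrow 4, while \<open>le\<close> keeps
      every power with exponent \<open>2 ^ N\<close> at most 4.\<close>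
    then obtain N where N: "4 < (norm (f h) / norm h) ^ N" using real_arch_pow by blast
    also have "\<dots> \<le> (norm (f h) / norm h) ^ 2 ^ N"
      using gt pos by (intro power_increasing less_imp_le[OF less_exp]) auto
    also have "\<dots> \<le> 4" using le[of N] pos by (simp add: power_divide field_simps)
    finally show False by simp
  qed
  have "(norm (f x))\<^sup>2 = norm (f (star x * x))"
    using x cstarD(5)[OF A x] by (simp add: star_homD[OF f] norm_star_mult_self)
  also have "\<dots> \<le> norm (star x * x)"
    using x by (intro sa cstarD[OF A]) (simp_all add: star_mult star_star)
  also have "\<dots> = (norm x)\<^sup>2" by (rule norm_star_mult_self)
  finally show ?thesis by (rule power2_le_imp_le) simp
qed

section \<open>The open mapping theorem\<close>

text \<open>Lifting the remaining error again and again halves it each time, so the lifts are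
  dominated by a geometric series with sum \<open>2 * M * norm y\<close>. This serves both the open
  mapping theorem and surjectivity of the induced map.\<close>

lemma approximate_lift_imp_lift:
  fixes T :: "'a::banach \<Rightarrow> 'b::real_normed_vector"
  assumes E: "closed E" "subspace E" and F: "subspace F"
    and T: "T ` E \<subseteq> F" and add: "\<And>x y. x \<in> E \<Longrightarrow> y \<in> E \<Longrightarrow> T (x + y) = T x + T y"
    and bound: "\<And>x. x \<in> E \<Longrightarrow> norm (T x) \<le> C * norm x" and M: "0 \<le> M"
    and lift: "\<And>y. y \<in> F \<Longrightarrow> \<exists>x\<in>E. norm x \<le> M * norm y \<and> norm (y - T x) \<le> norm y / 2"
    and y: "y \<in> F"
  obtains x where "x \<in> E" "T x = y" "norm x \<le> 2 * M * norm y"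
proof -
  from lift obtain L where L: "\<And>y. y \<in> F \<Longrightarrow> L y \<in> E" "\<And>y. y \<in> F \<Longrightarrow> norm (L y) \<le> M * norm y"
    "\<And>y. y \<in> F \<Longrightarrow> norm (y - T (L y)) \<le> norm y / 2"
    by metis
  \<comment> \<open>\<open>r n\<close> is the error left after \<open>n\<close> corrections.\<close>
  define r where "r = rec_nat y (\<lambda>_ z. z - T (L z))"
  have r0: "r 0 = y" and rS: "r (Suc n) = r n - T (L (r n))" for n
    by (simp_all add: r_def)
  have r: "r n \<in> F \<and> norm (r n) \<le> norm y / 2 ^ n" for n
  proof (induction n)
    case (Suc n)
    then have "r (Suc n) \<in> F"
      unfolding rS using T L(1) by (intro subspace_diff[OF F]) auto
    moreover have "norm (r (Suc n)) \<le> norm (r n) / 2" unfolding rS using Suc L(3) by blast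
    moreover have "norm (r n) / 2 \<le> (norm y / 2 ^ n) / 2"
      using Suc by (intro divide_right_mono) auto
    ultimately show ?case by simp
  qed (simp add: r0 y)
  let ?x = "\<lambda>n. \<Sum>k<n. L (r k)"
  have T0: "T 0 = 0" using add[of 0 0] subspace_0[OF E(2)] by simp
  have xE: "?x n \<in> E" for n using L(1) r by (intro subspace_sum[OF E(2)]) auto
  have Tx: "T (?x n) = y - r n" for n
  proof (induction n)
    case (Suc n)
    then show ?case using add[OF xE[of n] L(1)] r by (simp add: rS)
  qed (simp add: T0 r0)
  have le: "norm (L (r k)) \<le> (M * norm y) * (1 / 2) ^ k" for k
  proof -
    have "norm (L (r k)) \<le> M * norm (r k)" using L(2) r by blast
    also have "\<dots> \<le> M * (norm y / 2 ^ k)" using r M by (intro mult_left_mono) auto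
    finally show ?thesis by (simp add: power_divide)
  qed
  have geo: "(\<lambda>k. (M * norm y) * (1 / 2) ^ k) sums ((M * norm y) * 2)"
    using geometric_sums[of "1 / 2 :: real"] by (intro sums_mult) simp
  have sn: "summable (\<lambda>k. norm (L (r k)))"
    by (rule summable_comparison_test'[OF sums_summable[OF geo]]) (use le in auto)
  define x where "x = (\<Sum>k. L (r k))"
  have lim: "?x \<longlonglongrightarrow> x"
    unfolding x_def by (rule summable_LIMSEQ[OF summable_norm_cancel[OF sn]])
  have x: "x \<in> E" using closed_sequentially[OF E(1) _ lim] xE by blast
  have "norm x \<le> (\<Sum>k. norm (L (r k)))" unfolding x_def by (rule summable_norm[OF sn])
  also have "\<dots> \<le> (\<Sum>k. (M * norm y) * (1 / 2) ^ k)"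
    by (intro suminf_le le sn sums_summable[OF geo])
  also have "\<dots> = 2 * M * norm y" using sums_unique[OF geo] by simp
  finally have nx: "norm x \<le> 2 * M * norm y" .
  \<comment> \<open>As \<open>T\<close> is additive only on \<open>E\<close>, passing to the limit
    is done by hand: the right side tends to 0 by \<open>bound\<close>, and \<open>r n\<close> tends
    to 0.\<close>
  have Tr: "T x - y + r n = T (x - ?x n)" for n
    using add[OF subspace_diff[OF E(2) x xE[of n]] xE[of n]] Tx[of n] by simp
  have "(\<lambda>n. C * norm (x - ?x n)) \<longlonglongrightarrow> C * norm (x - x)"
    by (intro tendsto_intros lim)
  then have "(\<lambda>n. C * norm (x - ?x n)) \<longlonglongrightarrow> 0" by simp
  moreover have "norm (T x - y + r n) \<le> C * norm (x - ?x n)" for n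
    unfolding Tr by (rule bound[OF subspace_diff[OF E(2) x xE]])
  ultimately have "(\<lambda>n. T x - y + r n) \<longlonglongrightarrow> 0"
    by (rule Lim_null_comparison[OF always_eventually, OF allI, rotated])
  moreover have "(\<lambda>n. norm y * (1 / 2) ^ n) \<longlonglongrightarrow> norm y * 0"
    by (intro tendsto_intros LIMSEQ_realpow_zero) auto
  then have "(\<lambda>n. norm y / 2 ^ n) \<longlonglongrightarrow> 0" by (simp add: power_divide)
  then have "r \<longlonglongrightarrow> 0"
    by (rule Lim_null_comparison[OF always_eventually, OF allI, rotated]) (use r in blast)
  then have "(\<lambda>n. T x - y + r n) \<longlonglongrightarrow> T x - y + 0" by (intro tendsto_intros)
  ultimately have "T x = y" using LIMSEQ_unique by fastforce
  with x nx that show thesis by auto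
qed

text \<open>The classical Baire argument, carried out inside the closed subspace \<open>F\<close>
  because carriers are sets rather than types. It yields approximate lifts, which
  \<open>approximate_lift_imp_lift\<close> makes exact.\<close>

theorem open_mapping_bounded_lift:
  fixes T :: "'a::banach \<Rightarrow> 'b::banach"
  assumes E: "closed E" "subspace E" and F: "closed F" "subspace F"
    and T: "T ` E = F" and add: "\<And>x y. x \<in> E \<Longrightarrow> y \<in> E \<Longrightarrow> T (x + y) = T x + T y"
    and scale: "\<And>c x. x \<in> E \<Longrightarrow> T (c *\<^sub>R x) = c *\<^sub>R T x"
    and bound: "\<And>x. x \<in> E \<Longrightarrow> norm (T x) \<le> C * norm x"
  obtains M where "0 \<le> M" "\<And>y. y \<in> F \<Longrightarrow> \<exists>x\<in>E. T x = y \<and> norm x \<le> M * norm y"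
proof -
  let ?D = "\<lambda>n::nat. closure (T ` (E \<inter> cball 0 n))"
  let ?X = "top_of_set F"
  have sub: "?D n \<subseteq> F" for n using T by (intro closure_minimal F) auto
  \<comment> \<open>The closed sets \<open>?D n\<close> cover \<open>F\<close>. If all had empty
    interior, Baire would give \<open>F\<close> empty interior in itself, although \<open>0\<close>
    belongs to \<open>F\<close>.\<close>
  have "\<exists>n. ?X interior_of ?D n \<noteq> {}"
  proof (rule ccontr)
    assume "\<nexists>n. ?X interior_of ?D n \<noteq> {}"
    moreover have "completely_metrizable_space ?X"
      using F(1) by (simp add: completely_metrizable_space_closedin
          completely_metrizable_space_euclidean)
    moreover have "closedin ?X (?D n)" for n using sub by (simp add: closed_subset)
    ultimately have "?X interior_of \<Union> (range ?D) = {}"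
      by (intro Baire_category_alt) auto
    moreover have "F \<subseteq> \<Union> (range ?D)"
    proof
      fix y assume "y \<in> F"
      then obtain x where x: "x \<in> E" "y = T x" using T by auto
      obtain n :: nat where "norm x \<le> n" using real_arch_simple by blast
      with x have "y \<in> T ` (E \<inter> cball 0 n)" by auto
      then have "y \<in> ?D n" using closure_subset by (rule subsetD[rotated])
      then show "y \<in> \<Union> (range ?D)" by blast
    qed
    then have "\<Union> (range ?D) = F" using sub by blast
    ultimately have "F = {}" using interior_of_topspace[of ?X] by simp
    then show False using subspace_0[OF F(2)] by simp
  qed
  then obtain n y0 where "y0 \<in> ?X interior_of ?D n" by blast
  then obtain U where "openin ?X U" "y0 \<in> U" "U \<subseteq> ?D n" by (auto simp: interior_of_def)
  then obtain \<rho> where \<rho>: "\<rho> > 0" and y0: "y0 \<in> F"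
    and ball: "\<And>y. y \<in> F \<Longrightarrow> dist y y0 < \<rho> \<Longrightarrow> y \<in> ?D n"
    unfolding openin_euclidean_subtopology_iff by blast
  \<comment> \<open>A nonzero \<open>y\<close> is scaled to norm \<open>\<rho> / 2\<close>, lifted
    with norm at most \<open>2 * n\<close> and error below \<open>\<rho> / 4\<close>. Scaling back
    by \<open>2 * norm y / \<rho>\<close> gives this factor and error at most
    \<open>norm y / 2\<close>.\<close>
  define M where "M = 4 * n / \<rho>"
  have M: "0 \<le> M" using \<rho> by (simp add: M_def)
  have Tdiff: "T (x - y) = T x - T y" if "x \<in> E" "y \<in> E" for x y
    using add[OF subspace_diff[OF E(2) that] that(2)] by simp
  \<comment> \<open>Subtracting approximate preimages of \<open>y0 + y\<close> and \<open>y0\<close>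
    moves the ball from \<open>y0\<close> to the origin, at the price of doubling the norm
    bound.\<close>
  have small: "\<exists>x\<in>E. norm x \<le> 2 * n \<and> norm (y - T x) < e"
    if y: "y \<in> F" "norm y < \<rho>" and e: "e > 0" for y e
  proof -
    have "y0 + y \<in> ?D n" "y0 \<in> ?D n"
      using ball[of "y0 + y"] ball[of y0] y y0 \<rho> by (auto simp: dist_norm subspace_add[OF F(2)])
    then have "\<exists>u\<in>E \<inter> cball 0 n. dist (T u) (y0 + y) < e / 2"
      "\<exists>v\<in>E \<inter> cball 0 n. dist (T v) y0 < e / 2"
      using half_gt_zero[OF e] unfolding closure_approachable by blast+
    then obtain u v where u: "u \<in> E" "norm u \<le> n" "dist (T u) (y0 + y) < e / 2"
      and v: "v \<in> E" "norm v \<le> n" "dist (T v) y0 < e / 2"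
      by auto
    have "norm (u - v) \<le> 2 * n" using norm_triangle_ineq4[of u v] u v by simp
    moreover have eq: "y - T (u - v) = (T v - y0) - (T u - (y0 + y))"
      using Tdiff[OF u(1) v(1)] by simp
    have "norm (y - T (u - v)) < e"
      using norm_triangle_ineq4[of "T v - y0" "T u - (y0 + y)"] u(3) v(3)
      unfolding eq dist_norm by linarith
    ultimately show ?thesis using subspace_diff[OF E(2) u(1) v(1)] by blast
  qed
  have lift: "\<exists>x\<in>E. norm x \<le> M * norm y \<and> norm (y - T x) \<le> norm y / 2" if y: "y \<in> F" for y
  proof (cases "y = 0")
    case True
    then show ?thesis using subspace_0[OF E(2)] scale[of 0 0] by (intro bexI[of _ 0]) auto
  next
    case False
    define c where "c = \<rho> / (2 * norm y)"
    have c: "c > 0" using False \<rho> by (simp add: c_def)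
    have "norm (c *\<^sub>R y) < \<rho>" using False \<rho> by (simp add: c_def)
    then obtain x where x: "x \<in> E" "norm x \<le> 2 * n" "norm (c *\<^sub>R y - T x) < \<rho> / 4"
      using small[of "c *\<^sub>R y" "\<rho> / 4"] \<rho> subspace_scale[OF F(2) y] by auto
    let ?x = "inverse c *\<^sub>R x"
    have "?x \<in> E" using x subspace_scale[OF E(2)] by auto
    moreover have "norm ?x \<le> inverse c * (2 * n)" using x c by simp
    then have "norm ?x \<le> M * norm y" using False \<rho> by (simp add: c_def M_def field_simps)
    moreover have "y - T ?x = inverse c *\<^sub>R (c *\<^sub>R y - T x)"
      using c by (simp add: scale[OF x(1)] scaleR_diff_right)
    then have "norm (y - T ?x) = inverse c * norm (c *\<^sub>R y - T x)" using c by simp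
    then have "norm (y - T ?x) \<le> inverse c * (\<rho> / 4)" using x(3) c by simp
    then have "norm (y - T ?x) \<le> norm y / 2" using False \<rho> by (simp add: c_def field_simps)
    ultimately show ?thesis by blast
  qed
  show thesis
  proof (rule that[of "2 * M"])
    fix y assume "y \<in> F"
    then obtain x where "x \<in> E" "T x = y" "norm x \<le> 2 * M * norm y"
      using approximate_lift_imp_lift[OF E F(2) _ add bound M lift] T by blast
    then show "\<exists>x\<in>E. T x = y \<and> norm x \<le> 2 * M * norm y" by blast
  qed (use M in simp)
qed

section \<open>The Cauchy extension as an algebra of uniformly continuous functions\<close>

text \<open>Uniform continuity on \<open>K\<close> amounts to having a continuous extension to the
  compact closure of \<open>K\<close>. The discrete domain and the value 0 off \<open>K\<close>
  match the encoding of \<open>cps_emb\<close>.\<close>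

definition uc_functions :: "real set \<Rightarrow> 'a::cstar_algebra set \<Rightarrow> (real discrete \<Rightarrow>\<^sub>C 'a) set" where
  "uc_functions K A = {F :: real discrete \<Rightarrow>\<^sub>C 'a.
     (\<forall>s. F s \<in> A) \<and> (\<forall>s. of_discrete s \<notin> K \<longrightarrow> F s = 0) \<and>
     uniformly_continuous_on K (\<lambda>t. F (discrete t))}"

lemma ex_extension_by_zero:
  fixes h :: "real \<Rightarrow> 'a::real_normed_vector"
  assumes "\<And>t. t \<in> K \<Longrightarrow> norm (h t) \<le> m"
  shows "\<exists>F :: real discrete \<Rightarrow>\<^sub>C 'a.
    \<forall>s. F s = (if of_discrete s \<in> K then h (of_discrete s) else 0)"
proof (intro exI allI)
  let ?F = "\<lambda>s. if of_discrete s \<in> K then h (of_discrete s) else 0"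
  have "?F \<in> bcontfun"
  proof (rule bcontfun_normI)
    \<comment> \<open>The maximum covers the value 0 off \<open>K\<close>, since \<open>m\<close>
      may be negative when \<open>K\<close> is empty.\<close>
    show "norm (?F s) \<le> max 0 m" for s using assms[of "of_discrete s"] by auto
  qed (simp add: continuous_on_open_vimage open_discrete)
  then show "Bcontfun ?F s = ?F s" for s by (simp add: Bcontfun_inverse)
qed

section \<open>Power series give uniformly continuous functions\<close>

lemma continuous_on_cps_eval:
  assumes "a \<in> cps A"
  shows "continuous_on {-1..1} (cps_eval a)"
proof -
  have "uniform_limit {-1..1} (\<lambda>n t. \<Sum>k<n. t ^ k *\<^sub>R a k) (\<lambda>t. \<Sum>k. t ^ k *\<^sub>R a k) sequentially"
  proof (rule Weierstrass_m_test)
    show "summable (\<lambda>n. norm (a n))" using assms by (simp add: cps_def)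
    show "norm (t ^ n *\<^sub>R a n) \<le> norm (a n)" if "t \<in> {-1..1}" for n and t :: real
      using that power_le_one[of "\<bar>t\<bar>" n]
      by (auto simp: power_abs intro!: mult_left_le_one_le)
  qed
  then show ?thesis
    unfolding cps_eval_def
    by (rule uniform_limit_theorem[rotated]) (auto intro!: always_eventually continuous_intros)
qed

lemma cps_eval_closed:
  assumes A: "cstar A" and a: "a \<in> cps A" and t: "\<bar>t\<bar> \<le> 1"
  shows "cps_eval a t \<in> A"
proof -
  \<comment> \<open>The identity is a contractive homomorphism, so the membership half of
    \<open>cps_eval_map\<close> applies.\<close>
  have id: "star_hom A A (\<lambda>x. x)" by (simp add: star_hom_def)
  show ?thesis by (rule cps_eval_map(1)[OF A id order_refl a t])
qed

lemma cps_emb_in_uc_functions: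
  assumes K: "K \<subseteq> {-1..1}" and A: "cstar A" and a: "a \<in> cps A"
  shows "cps_emb K a \<in> uc_functions K A"
proof -
  have "uniformly_continuous_on {-1..1} (cps_eval a)"
    by (intro compact_uniformly_continuous continuous_on_cps_eval[OF a]) simp
  then have "uniformly_continuous_on K (cps_eval a)"
    using K unfolding uniformly_continuous_on_def by (meson subsetD)
  then have "uniformly_continuous_on K (\<lambda>t. cps_emb K a (discrete t))"
    by (simp add: apply_cps_emb[OF K a] discrete_inverse uniformly_continuous_on_def)
  moreover have "\<bar>t\<bar> \<le> 1" if "t \<in> K" for t using K that by (auto simp: abs_le_iff)
  ultimately show ?thesis
    using cps_eval_closed[OF A a] cstarD(2)[OF A]
    by (simp add: uc_functions_def apply_cps_emb[OF K a])
qed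

text \<open>Convergence in the supremum norm is uniform in the argument, so each of the three
  defining properties passes to limits.\<close>

lemma closed_uc_functions:
  assumes A: "closed A"
  shows "closed (uc_functions K A)"
proof -
  have "F \<in> uc_functions K A" if F: "F \<in> closure (uc_functions K A)" for F
  proof -
    have app: "\<exists>G\<in>uc_functions K A. \<forall>s. dist (G s) (F s) < e" if "e > 0" for e
      using F that dist_fun_lt_imp_dist_val_lt unfolding closure_approachable by blast
    have "F s \<in> A" for s
    proof -
      have "\<exists>y\<in>A. dist y (F s) < e" if "e > 0" for e
        using app[OF that] by (auto simp: uc_functions_def)
      then have "F s \<in> closure A" unfolding closure_approachable by blast
      then show ?thesis using A by simp
    qed
    moreover have "F s = 0" if s: "of_discrete s \<notin> K" for s
    proof (rule ccontr)
      assume "F s \<noteq> 0"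
      then obtain G where "G \<in> uc_functions K A" "dist (G s) (F s) < norm (F s)"
        using app[of "norm (F s)"] by auto
      then show False using s by (simp add: uc_functions_def dist_norm)
    qed
    moreover have "uniformly_continuous_on K (\<lambda>t. F (discrete t))"
      unfolding uniformly_continuous_on_def
    proof (intro allI impI)
      fix e :: real assume "e > 0"
      then obtain G where G: "G \<in> uc_functions K A" "\<And>s. dist (G s) (F s) < e / 3"
        using app[of "e / 3"] by auto
      then have "uniformly_continuous_on K (\<lambda>t. G (discrete t))" by (simp add: uc_functions_def)
      then obtain d where d: "d > 0" "\<And>x y. x \<in> K \<Longrightarrow> y \<in> K \<Longrightarrow> dist y x < d \<Longrightarrow>
          dist (G (discrete y)) (G (discrete x)) < e / 3"
        using \<open>e > 0\<close> unfolding uniformly_continuous_on_def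
        by (metis zero_less_divide_iff zero_less_numeral)
      have "dist (F (discrete y)) (F (discrete x)) < e" if "x \<in> K" "y \<in> K" "dist y x < d" for x y
        using d(2)[OF that] G(2)[of "discrete x"] G(2)[of "discrete y"]
          dist_triangle[of "F (discrete y)" "F (discrete x)" "G (discrete y)"]
          dist_triangle[of "G (discrete y)" "F (discrete x)" "G (discrete x)"]
          dist_commute[of "F (discrete y)" "G (discrete y)"]
        by linarith
      with d(1) show "\<exists>d>0. \<forall>x\<in>K. \<forall>y\<in>K. dist y x < d \<longrightarrow> dist (F (discrete y)) (F (discrete x)) < e"
        by blast
    qed
    ultimately show ?thesis by (simp add: uc_functions_def)
  qed
  then have "closure (uc_functions K A) \<subseteq> uc_functions K A" by blast
  then show ?thesis by (simp add: closure_subset_eq)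
qed

section \<open>Approximation of uniformly continuous functions by power series\<close>

lemma continuous_scaleR_in_cauchy_ext:
  assumes K: "K \<subseteq> {-1..1}" and A: "cstar A" and a: "a \<in> A"
    and \<phi>: "continuous_on {-1..1} \<phi>"
  obtains F where "F \<in> cauchy_ext K A"
    "\<And>s. apply_bcontfun F s = (if of_discrete s \<in> K then \<phi> (of_discrete s) *\<^sub>R a else 0)"
proof -
  have "bounded (\<phi> ` {-1..1})"
    by (intro compact_imp_bounded compact_continuous_image \<phi>) simp
  then obtain m where m: "\<forall>t\<in>{-1..1}. \<bar>\<phi> t\<bar> \<le> m" unfolding bounded_iff by auto
  have "norm (\<phi> t *\<^sub>R a) \<le> m * norm a" if "t \<in> K" for t
    using K m that by (force intro!: mult_right_mono)
  then obtain F where F: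
    "\<And>s. apply_bcontfun F s = (if of_discrete s \<in> K then \<phi> (of_discrete s) *\<^sub>R a else 0)"
    using ex_extension_by_zero[of K "\<lambda>t. \<phi> t *\<^sub>R a" "m * norm a"] by auto
  have "\<exists>y\<in>cps_emb K ` cps A. dist y F < e" if e: "e > 0" for e
  proof -
    \<comment> \<open>Adding 1 keeps the denominator positive when \<open>a = 0\<close>; halving
      \<open>e\<close> yields a strict inequality at the end.\<close>
    define e' where "e' = e / 2 / (norm a + 1)"
    have pos: "norm a + 1 > 0" using norm_ge_zero[of a] by linarith
    have e': "e' > 0" using e pos by (simp add: e'_def)
    obtain p where "real_polynomial_function p" and p: "\<And>t. t \<in> {-1..1} \<Longrightarrow> \<bar>\<phi> t - p t\<bar> < e'"
      using Stone_Weierstrass_real_polynomial_function[OF _ \<phi> e'] by auto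
    then obtain c n where c: "p = (\<lambda>t. \<Sum>i\<le>n. c i * t ^ i)"
      unfolding real_polynomial_function_iff_sum by blast
    \<comment> \<open>The Weierstrass polynomial times \<open>a\<close> is a power series with
      finitely many nonzero coefficients, hence an element of \<open>cps A\<close>.\<close>
    define \<alpha> where "\<alpha> i = (if i \<le> n then c i *\<^sub>R a else 0)" for i :: nat
    have "summable (\<lambda>i. norm (\<alpha> i))"
      by (rule summable_finite[of "{..n}"]) (auto simp: \<alpha>_def)
    then have \<alpha>: "\<alpha> \<in> cps A" using a A by (simp add: cps_def \<alpha>_def cstarD)
    have ev: "cps_eval \<alpha> t = p t *\<^sub>R a" for t
    proof -
      have "cps_eval \<alpha> t = (\<Sum>i\<le>n. t ^ i *\<^sub>R \<alpha> i)"
        unfolding cps_eval_def by (rule suminf_finite) (auto simp: \<alpha>_def)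
      also have "\<dots> = p t *\<^sub>R a"
        unfolding c scaleR_sum_left by (intro sum.cong) (auto simp: \<alpha>_def mult.commute)
      finally show ?thesis .
    qed
    have "dist (cps_emb K \<alpha>) F \<le> e / 2"
    proof (rule dist_bound)
      fix s
      show "dist (cps_emb K \<alpha> s) (F s) \<le> e / 2"
      proof (cases "of_discrete s \<in> K")
        case True
        let ?t = "of_discrete s"
        have "dist (cps_emb K \<alpha> s) (F s) = \<bar>\<phi> ?t - p ?t\<bar> * norm a"
          using True by (simp add: apply_cps_emb[OF K \<alpha>] F ev dist_norm abs_minus_commute
              flip: scaleR_diff_left)
        also have "\<dots> \<le> e' * (norm a + 1)"
          using p[of ?t] True K e' by (intro mult_mono) auto
        also have "\<dots> = e / 2" using pos unfolding e'_def
          by (subst nonzero_eq_divide_eq[symmetric]) auto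
        finally show ?thesis .
      qed (use e in \<open>simp add: apply_cps_emb[OF K \<alpha>] F\<close>)
    qed
    then show ?thesis using e \<alpha> by (intro bexI[of _ "cps_emb K \<alpha>"]) auto
  qed
  then have "F \<in> cauchy_ext K A" unfolding cauchy_ext_def closure_approachable by blast
  then show thesis using F that by blast
qed

lemma sum_scaleR_in_cauchy_ext:
  assumes K: "K \<subseteq> {-1..1}" and A: "cstar A" and "finite I"
    and \<phi>: "\<And>i. continuous_on {-1..1} (\<phi> i)" and b: "\<And>i. i \<in> I \<Longrightarrow> b i \<in> A"
  shows "\<exists>F\<in>cauchy_ext K A. \<forall>s. F s =
    (if of_discrete s \<in> K then \<Sum>i\<in>I. \<phi> i (of_discrete s) *\<^sub>R b i else 0)"
  using \<open>finite I\<close> b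
proof (induction I)
  case empty
  then show ?case
    using cstarD(2)[OF cstar_cauchy_ext[OF A K]] by (intro bexI[of _ 0]) auto
next
  case (insert i I)
  then obtain F where F: "F \<in> cauchy_ext K A"
    "\<And>s. apply_bcontfun F s = (if of_discrete s \<in> K then \<Sum>i\<in>I. \<phi> i (of_discrete s) *\<^sub>R b i else 0)"
    by auto
  obtain G where G: "G \<in> cauchy_ext K A"
    "\<And>s. apply_bcontfun G s = (if of_discrete s \<in> K then \<phi> i (of_discrete s) *\<^sub>R b i else 0)"
    using continuous_scaleR_in_cauchy_ext[OF K A _ \<phi>, of "b i" i] insert.prems by auto
  show ?case
    using F G insert.hyps cstarD(6)[OF cstar_cauchy_ext[OF A K] G(1) F(1)]
    by (intro bexI[of _ "G + F"]) auto
qed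

text \<open>Finitely many balls centred in \<open>K\<close> cover its compact closure. Tent
  functions at the centres are normalised to sum 1 on \<open>K\<close>, so the error is an average
  of differences \<open>F t - F i\<close> between nearby points.\<close>

lemma uniformly_continuous_partition:
  fixes F :: "real \<Rightarrow> 'a::real_normed_vector"
  assumes K: "bounded K" and F: "uniformly_continuous_on K F" and e: "e > 0"
  obtains I \<phi> where "finite I" "I \<subseteq> K" "\<And>i. continuous_on UNIV (\<phi> i)"
    "\<And>i t. 0 \<le> (\<phi> i t :: real)" "\<And>t. t \<in> K \<Longrightarrow> (\<Sum>i\<in>I. \<phi> i t) = 1"
    "\<And>t. t \<in> K \<Longrightarrow> norm (F t - (\<Sum>i\<in>I. \<phi> i t *\<^sub>R F i)) \<le> e"
proof -
  obtain d where d: "d > 0" "\<And>x y. x \<in> K \<Longrightarrow> y \<in> K \<Longrightarrow> dist y x < d \<Longrightarrow> dist (F y) (F x) < e"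
    using F e unfolding uniformly_continuous_on_def by metis
  have "closure K \<subseteq> (\<Union>i\<in>K. ball i (d / 2))"
  proof
    fix x assume "x \<in> closure K"
    then obtain i where "i \<in> K" "dist i x < d / 2"
      using d(1) unfolding closure_approachable by (meson half_gt_zero)
    then show "x \<in> (\<Union>i\<in>K. ball i (d / 2))" by auto
  qed
  then obtain I where I: "I \<subseteq> K" "finite I" "closure K \<subseteq> (\<Union>i\<in>I. ball i (d / 2))"
    using compactE_image[of "closure K" K "\<lambda>i. ball i (d / 2)"] K by auto
  \<comment> \<open>The tent has support radius \<open>d\<close> but the covering balls have radius
    \<open>d / 2\<close>, so some tent is at least \<open>d / 2\<close> at each point of
    \<open>K\<close>.\<close>
  define \<psi> where "\<psi> i t = max 0 (d - \<bar>t - i\<bar>)" for i t :: real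
  define S where "S t = (\<Sum>i\<in>I. \<psi> i t)" for t
  \<comment> \<open>The maximum keeps the denominator positive on the whole line, and on
    \<open>K\<close> it equals \<open>S t\<close>.\<close>
  define \<phi> where "\<phi> i t = \<psi> i t / max (d / 2) (S t)" for i t
  have Spos: "S t \<ge> d / 2" if "t \<in> K" for t
  proof -
    have "t \<in> (\<Union>i\<in>I. ball i (d / 2))" using I(3) closure_subset \<open>t \<in> K\<close> by blast
    then obtain i where i: "i \<in> I" "\<bar>t - i\<bar> < d / 2"
      by (auto simp: dist_real_def abs_minus_commute)
    have "d / 2 \<le> \<psi> i t" using i(2) unfolding \<psi>_def by linarith
    also have "\<dots> \<le> S t" unfolding S_def by (rule member_le_sum) (use i I in \<open>auto simp: \<psi>_def\<close>)
    finally show ?thesis .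
  qed
  have nonneg: "0 \<le> \<phi> i t" for i t using d(1) by (simp add: \<phi>_def \<psi>_def)
  have one: "(\<Sum>i\<in>I. \<phi> i t) = 1" if "t \<in> K" for t
    using Spos[OF that] d(1) by (simp add: \<phi>_def S_def max_def flip: sum_divide_distrib)
  show thesis
  proof (rule that[OF I(2,1) _ nonneg one])
    have "max (d / 2) (S t) \<noteq> 0" for t using d(1) by (simp add: max_def)
    then show "continuous_on UNIV (\<phi> i)" for i
      unfolding \<phi>_def S_def \<psi>_def by (intro continuous_intros) auto
    fix t assume t: "t \<in> K"
    have "F t - (\<Sum>i\<in>I. \<phi> i t *\<^sub>R F i) = (\<Sum>i\<in>I. \<phi> i t *\<^sub>R (F t - F i))"
      using one[OF t] by (simp add: scaleR_diff_right sum_subtractf flip: scaleR_sum_left)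
    also have "norm \<dots> \<le> (\<Sum>i\<in>I. \<phi> i t * e)"
    proof (intro sum_norm_le)
      fix i assume i: "i \<in> I"
      show "norm (\<phi> i t *\<^sub>R (F t - F i)) \<le> \<phi> i t * e"
      proof (cases "\<bar>t - i\<bar> < d")
        case True
        then have "norm (F t - F i) \<le> e"
          using d(2)[of i t] i t I(1) by (auto simp: dist_norm)
        then show ?thesis using nonneg by (simp add: mult_left_mono)
      qed (simp add: \<phi>_def \<psi>_def)
    qed
    also have "\<dots> = e" using one[OF t] by (simp flip: sum_distrib_right)
    finally show "norm (F t - (\<Sum>i\<in>I. \<phi> i t *\<^sub>R F i)) \<le> e" .
  qed
qed

theorem cauchy_ext_eq_uc_functions:
  assumes K: "K \<subseteq> {-1..1}" and A: "cstar A"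
  shows "cauchy_ext K A = uc_functions K A"
proof
  show "cauchy_ext K A \<subseteq> uc_functions K A"
    unfolding cauchy_ext_def
    by (intro closure_minimal closed_uc_functions cstarD(1)[OF A])
      (auto simp: cps_emb_in_uc_functions[OF K A])
  show "uc_functions K A \<subseteq> cauchy_ext K A"
  proof
    fix F assume F: "F \<in> uc_functions K A"
    have "\<exists>G\<in>cauchy_ext K A. dist G F < e" if e: "e > 0" for e
    proof -
      have bK: "bounded K" by (rule bounded_subset[OF bounded_closed_interval K])
      have uc: "uniformly_continuous_on K (\<lambda>t. F (discrete t))"
        using F by (simp add: uc_functions_def)
      obtain I \<phi> where I: "finite I" "I \<subseteq> K"
        and \<phi>: "\<And>i. continuous_on UNIV (\<phi> i)" "\<And>i t. 0 \<le> (\<phi> i t :: real)"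
          "\<And>t. t \<in> K \<Longrightarrow> (\<Sum>i\<in>I. \<phi> i t) = 1"
        and le: "\<And>t. t \<in> K \<Longrightarrow> norm (F (discrete t) - (\<Sum>i\<in>I. \<phi> i t *\<^sub>R F (discrete i))) \<le> e / 2"
        by (rule uniformly_continuous_partition[OF bK uc half_gt_zero[OF e]]) (rule that)
      obtain G where G: "G \<in> cauchy_ext K A" "\<And>s. apply_bcontfun G s =
          (if of_discrete s \<in> K then \<Sum>i\<in>I. \<phi> i (of_discrete s) *\<^sub>R F (discrete i) else 0)"
        using sum_scaleR_in_cauchy_ext[OF K A I(1), of \<phi> "\<lambda>i. F (discrete i)"]
          continuous_on_subset[OF \<phi>(1)] F by (auto simp: uc_functions_def)
      have "dist G F \<le> e / 2"
      proof (rule dist_bound)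
        show "dist (G s) (F s) \<le> e / 2" for s
          using le[of "of_discrete s"] e F
          by (auto simp: G dist_norm norm_minus_commute of_discrete_inverse uc_functions_def)
      qed
      with G(1) e show ?thesis by (intro bexI[of _ G]) auto
    qed
    then have "F \<in> closure (cauchy_ext K A)" unfolding closure_approachable by blast
    then show "F \<in> cauchy_ext K A" by (simp add: cauchy_ext_def)
  qed
qed

section \<open>The induced map acts by composition\<close>

lemma continuous_on_star_hom:
  assumes A: "cstar A" and f: "star_hom A B f"
  shows "continuous_on A f"
proof -
  have "dist (f x) (f y) \<le> dist x y" if "x \<in> A" "y \<in> A" for x y
    using star_hom_contractive[OF A f cstarD(7)[OF A that]]
    by (simp add: dist_norm star_hom_diff[OF A f that])
  then show ?thesis unfolding continuous_on_iff by (meson le_less_trans)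
qed

lemma bounded_linear_apply_bcontfun:
  "bounded_linear (\<lambda>F :: 'a::topological_space \<Rightarrow>\<^sub>C 'b::real_normed_vector. F s)"
  by (rule bounded_linear_intro[where K = 1]) (simp_all add: norm_bounded)

text \<open>Both sides are continuous in \<open>F\<close> and agree on the dense image of the power
  series. This replaces the abstract extension by a pointwise formula.\<close>

lemma apply_cauchy_map:
  assumes K: "K \<subseteq> {-1..1}" and A: "cstar A" and f: "star_hom A B f"
    and F: "F \<in> cauchy_ext K A"
  shows "cauchy_map K A f F s = f (F s)"
proof -
  note ext = cauchy_map_extends[OF K A f star_hom_contractive[OF A f]]
  have ran: "F s \<in> A" if "F \<in> cauchy_ext K A" for F
    using that by (simp add: cauchy_ext_eq_uc_functions[OF K A] uc_functions_def)
  have "continuous_on (cauchy_ext K A) (\<lambda>F. cauchy_map K A f F s - f (F s))"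
  proof (rule continuous_on_diff)
    show "continuous_on (cauchy_ext K A) (\<lambda>F. cauchy_map K A f F s)"
      by (rule bounded_linear.continuous_on[OF bounded_linear_apply_bcontfun ext(1)])
    show "continuous_on (cauchy_ext K A) (\<lambda>F. f (F s))"
      by (rule continuous_on_compose2[OF continuous_on_star_hom[OF A f]])
        (use ran in \<open>auto intro!: linear_continuous_on bounded_linear_apply_bcontfun\<close>)
  qed
  then have "cauchy_map K A f F s - f (F s) = 0"
    unfolding cauchy_ext_def
  proof (rule continuous_constant_on_closure)
    fix G assume "G \<in> cps_emb K ` cps A"
    then obtain a where a: "a \<in> cps A" "G = cps_emb K a" by auto
    have "\<bar>t\<bar> \<le> 1" if "t \<in> K" for t using K that by (auto simp: abs_le_iff)
    then show "cauchy_map K A f G s - f (G s) = 0"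
      using cps_eval_map(2)[OF A f star_hom_contractive[OF A f] a(1)] a(1)
        cps_map_closed[OF f star_hom_contractive[OF A f] a(1)]
      by (simp add: a(2) ext(2) apply_cps_emb[OF K, of _ A] apply_cps_emb[OF K, of _ B]
          star_hom_0[OF A f])
  qed (use F in \<open>simp add: cauchy_ext_def\<close>)
  then show ?thesis by simp
qed

section \<open>Exactness\<close>

lemma cauchy_ext_apply_closed:
  assumes "K \<subseteq> {-1..1}" and "cstar A" and "F \<in> cauchy_ext K A"
  shows "F s \<in> A"
  using assms by (simp add: cauchy_ext_eq_uc_functions uc_functions_def)

text \<open>Composition with the contraction \<open>f\<close> preserves uniform continuity, and the
  algebraic identities hold pointwise.\<close>

lemma star_hom_cauchy_map:
  assumes K: "K \<subseteq> {-1..1}" and A: "cstar A" and B: "cstar B" and f: "star_hom A B f"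
  shows "star_hom (cauchy_ext K A) (cauchy_ext K B) (cauchy_map K A f)"
proof -
  note app = apply_cauchy_map[OF K A f]
  note ran = cauchy_ext_apply_closed[OF K A]
  note ext = cstarD[OF cstar_cauchy_ext[OF A K]]
  have "cauchy_map K A f F \<in> cauchy_ext K B" if F: "F \<in> cauchy_ext K A" for F
  proof -
    have F': "F \<in> uc_functions K A" using F by (simp add: cauchy_ext_eq_uc_functions[OF K A])
    have le: "dist (f (F s)) (f (F t)) \<le> dist (F s) (F t)" for s t
      using star_hom_contractive[OF A f cstarD(7)[OF A ran[OF F] ran[OF F]], of s t]
      by (simp add: dist_norm star_hom_diff[OF A f ran[OF F] ran[OF F]])
    have "uniformly_continuous_on K (\<lambda>t. f (F (discrete t)))"
      using F' le unfolding uc_functions_def uniformly_continuous_on_def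
      by (simp, meson le_less_trans)
    then show ?thesis
      using F' star_homD(1)[OF f] star_hom_0[OF A f]
      by (simp add: cauchy_ext_eq_uc_functions[OF K B] uc_functions_def app[OF F])
  qed
  then show ?thesis
    unfolding star_hom_def
    by (auto intro!: bcontfun_eqI simp: app ext ran star_homD[OF f])
qed

lemma star_hom_sum_scaleR:
  assumes A: "cstar A" and f: "star_hom A B f" and "finite I" and b: "\<And>i. i \<in> I \<Longrightarrow> b i \<in> A"
  shows "(\<Sum>i\<in>I. r i *\<^sub>R b i) \<in> A \<and> f (\<Sum>i\<in>I. r i *\<^sub>R b i) = (\<Sum>i\<in>I. r i *\<^sub>R f (b i))"
  using \<open>finite I\<close> b
  by (induction I) (auto simp: star_hom_0[OF A f] star_homD[OF f] cstarD[OF A])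

lemma inj_on_cauchy_map:
  assumes K: "K \<subseteq> {-1..1}" and A: "cstar A" and f: "star_hom A B f" and inj: "inj_on f A"
  shows "inj_on (cauchy_map K A f) (cauchy_ext K A)"
proof (rule inj_onI)
  fix F G assume FG: "F \<in> cauchy_ext K A" "G \<in> cauchy_ext K A"
    and eq: "cauchy_map K A f F = cauchy_map K A f G"
  show "F = G"
  proof (rule bcontfun_eqI)
    fix s
    have "f (F s) = f (G s)"
      using arg_cong[OF eq, of "\<lambda>H. apply_bcontfun H s"]
      by (simp add: apply_cauchy_map[OF K A f] FG)
    then show "F s = G s"
      using inj_onD[OF inj] cauchy_ext_apply_closed[OF K A] FG by blast
  qed
qed

text \<open>By exactness this kernel is the range of the preceding map, which supplies the closed
  range required by the open mapping theorem.\<close>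

lemma closed_kernel:
  assumes A: "cstar A" and f: "star_hom A B f"
  shows "closed {x \<in> A. f x = 0}"
proof -
  have "{x \<in> A. f x = 0} = A \<inter> f -` {0}" by auto
  then show ?thesis
    using continuous_closed_preimage[OF continuous_on_star_hom[OF A f] cstarD(1)[OF A], of "{0}"]
    by simp
qed

text \<open>
  By the open mapping theorem \<open>f\<close> is bounded below, so that \<open>f\<inverse> \<circ> G\<close> is again uniformly
  continuous.
\<close>

lemma cauchy_map_lift_range:
  assumes K: "K \<subseteq> {-1..1}" and A: "cstar A" and B: "cstar B" and f: "star_hom A B f"
    and inj: "inj_on f A" and im: "closed (f ` A)"
    and G: "G \<in> cauchy_ext K B" and range: "\<And>s. G s \<in> f ` A"
  shows "G \<in> cauchy_map K A f ` cauchy_ext K A"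
proof -
  have sub: "subspace (f ` A)"
  proof (rule subspaceI)
    show "0 \<in> f ` A" using star_hom_0[OF A f] cstarD(2)[OF A] by (metis image_eqI)
    show "x + y \<in> f ` A" if "x \<in> f ` A" "y \<in> f ` A" for x y
      using that star_homD(2)[OF f] cstarD(6)[OF A] by (metis (no_types, lifting) imageE imageI)
    show "c *\<^sub>R x \<in> f ` A" if "x \<in> f ` A" for c x
      using that star_homD(6)[OF f] cstarD(8)[OF A] by (metis (no_types, lifting) imageE imageI)
  qed
  obtain M where M: "0 \<le> M" "\<And>y. y \<in> f ` A \<Longrightarrow> \<exists>x\<in>A. f x = y \<and> norm x \<le> M * norm y"
    using open_mapping_bounded_lift[OF cstarD(1)[OF A] cstar_subspace[OF A] im sub refl
      star_homD(2)[OF f] star_homD(6)[OF f], of 1] star_hom_contractive[OF A f] by auto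
  \<comment> \<open>By injectivity the bounded preimage of \<open>f x\<close> can only be
    \<open>x\<close>.\<close>
  have below: "norm x \<le> M * norm (f x)" if "x \<in> A" for x
    using M(2)[of "f x"] inj_onD[OF inj] that by auto
  define \<psi> where "\<psi> s = inv_into A f (G s)" for s
  have \<psi>: "\<psi> s \<in> A" "f (\<psi> s) = G s" for s
    unfolding \<psi>_def by (rule inv_into_into[OF range], rule f_inv_into_f[OF range])
  have "norm (\<psi> s) \<le> M * norm G" for s
    using below[OF \<psi>(1)[of s]] mult_left_mono[OF norm_bounded[of G s] M(1)] \<psi>(2)[of s] by simp
  then obtain H :: "real discrete \<Rightarrow>\<^sub>C 'a"
    where H: "\<And>s. apply_bcontfun H s =
      (if of_discrete s \<in> K then \<psi> (discrete (of_discrete s)) else 0)"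
    using ex_extension_by_zero[of K "\<lambda>t. \<psi> (discrete t)" "M * norm G"] by auto
  have G': "G \<in> uc_functions K B" using G by (simp add: cauchy_ext_eq_uc_functions[OF K B])
  \<comment> \<open>The constant \<open>M + 1\<close> is positive even if \<open>M = 0\<close>, so
    \<open>e / (M + 1)\<close> is a valid tolerance below.\<close>
  have le: "dist (\<psi> s) (\<psi> t) \<le> (M + 1) * dist (G s) (G t)" for s t
  proof -
    have "dist (\<psi> s) (\<psi> t) \<le> M * dist (G s) (G t)"
      using below[OF cstarD(7)[OF A \<psi>(1) \<psi>(1)], of s t]
      by (simp add: dist_norm star_hom_diff[OF A f \<psi>(1) \<psi>(1)] \<psi>(2))
    also have "\<dots> \<le> (M + 1) * dist (G s) (G t)" by (intro mult_right_mono) auto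
    finally show ?thesis .
  qed
  have "uniformly_continuous_on K (\<lambda>t. \<psi> (discrete t))"
    unfolding uniformly_continuous_on_def
  proof (intro allI impI)
    fix e :: real assume "e > 0"
    then have "e / (M + 1) > 0" using M(1) by simp
    then obtain d where d: "d > 0" "\<And>x y. x \<in> K \<Longrightarrow> y \<in> K \<Longrightarrow> dist y x < d \<Longrightarrow>
        dist (G (discrete y)) (G (discrete x)) < e / (M + 1)"
      using G' unfolding uc_functions_def uniformly_continuous_on_def by blast
    have "dist (\<psi> (discrete y)) (\<psi> (discrete x)) < e" if "x \<in> K" "y \<in> K" "dist y x < d" for x y
    proof -
      have "(M + 1) * dist (G (discrete y)) (G (discrete x)) < (M + 1) * (e / (M + 1))"
        using d(2)[OF that] M(1) by (intro mult_strict_left_mono) auto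
      also have "\<dots> = e" using M(1) by simp
      finally show ?thesis using le[of "discrete y" "discrete x"] by simp
    qed
    with d(1) show "\<exists>d>0. \<forall>x\<in>K. \<forall>y\<in>K. dist y x < d \<longrightarrow> dist (\<psi> (discrete y)) (\<psi> (discrete x)) < e"
      by blast
  qed
  then have "uniformly_continuous_on K (\<lambda>t. H (discrete t))"
    by (simp add: H discrete_inverse uniformly_continuous_on_def)
  then have HA: "H \<in> cauchy_ext K A"
    using \<psi>(1) cstarD(2)[OF A] by (simp add: cauchy_ext_eq_uc_functions[OF K A] uc_functions_def H)
  have "cauchy_map K A f H = G"
  proof (rule bcontfun_eqI)
    show "cauchy_map K A f H s = G s" for s
      using G' by (auto simp: apply_cauchy_map[OF K A f HA] H of_discrete_inverse \<psi>(2)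
          star_hom_0[OF A f] uc_functions_def)
  qed
  with HA show ?thesis by blast
qed

text \<open>Pointwise lifts chosen separately need not vary continuously. Only finitely many values
  are lifted and then blended by a partition of unity; this is a lift up to half the norm, which
  \<open>approximate_lift_imp_lift\<close> completes.\<close>

lemma surj_cauchy_map:
  assumes K: "K \<subseteq> {-1..1}" and B: "cstar B" and C: "cstar C" and g: "star_hom B C g"
    and surj: "g ` B = C"
  shows "cauchy_map K B g ` cauchy_ext K B = cauchy_ext K C"
proof
  let ?T = "cauchy_map K B g" and ?E = "cauchy_ext K B" and ?F = "cauchy_ext K C"
  note T = star_hom_cauchy_map[OF K B C g]
  note csB = cstar_cauchy_ext[OF B K] and csC = cstar_cauchy_ext[OF C K]
  show im: "?T ` ?E \<subseteq> ?F" using star_homD(1)[OF T] by blast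
  obtain M where M: "0 \<le> M" "\<And>y. y \<in> C \<Longrightarrow> \<exists>x\<in>B. g x = y \<and> norm x \<le> M * norm y"
    using open_mapping_bounded_lift[OF cstarD(1)[OF B] cstar_subspace[OF B] cstarD(1)[OF C]
      cstar_subspace[OF C] surj star_homD(2)[OF g] star_homD(6)[OF g], of 1]
      star_hom_contractive[OF B g] by auto
  have lift: "\<exists>X\<in>?E. norm X \<le> M * norm Y \<and> norm (Y - ?T X) \<le> norm Y / 2" if Y: "Y \<in> ?F" for Y
  proof (cases "Y = 0")
    case True
    then show ?thesis
      using cstarD(2)[OF csB] star_hom_0[OF csB T] by (intro bexI[of _ 0]) auto
  next
    case False
    have Y': "Y \<in> uc_functions K C" using Y by (simp add: cauchy_ext_eq_uc_functions[OF K C])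
    have bK: "bounded K" by (rule bounded_subset[OF bounded_closed_interval K])
    have uc: "uniformly_continuous_on K (\<lambda>t. Y (discrete t))"
      using Y' by (simp add: uc_functions_def)
    have e: "norm Y / 2 > 0" using False by simp
    obtain I \<phi> where I: "finite I" "I \<subseteq> K"
      and \<phi>: "\<And>i. continuous_on UNIV (\<phi> i)" "\<And>i t. 0 \<le> (\<phi> i t :: real)"
        "\<And>t. t \<in> K \<Longrightarrow> (\<Sum>i\<in>I. \<phi> i t) = 1"
      and le: "\<And>t. t \<in> K \<Longrightarrow>
        norm (Y (discrete t) - (\<Sum>i\<in>I. \<phi> i t *\<^sub>R Y (discrete i))) \<le> norm Y / 2"
      by (rule uniformly_continuous_partition[OF bK uc e]) (rule that)
    have "\<exists>x\<in>B. g x = Y (discrete i) \<and> norm x \<le> M * norm Y" for i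
      using M(2)[OF cauchy_ext_apply_closed[OF K C Y, of "discrete i"]]
        mult_left_mono[OF norm_bounded[of Y "discrete i"] M(1)] by fastforce
    then obtain b where b: "\<And>i. b i \<in> B" "\<And>i. g (b i) = Y (discrete i)"
      "\<And>i. norm (b i) \<le> M * norm Y"
      by metis
    obtain X where X: "X \<in> ?E" "\<And>s. apply_bcontfun X s =
        (if of_discrete s \<in> K then \<Sum>i\<in>I. \<phi> i (of_discrete s) *\<^sub>R b i else 0)"
      using sum_scaleR_in_cauchy_ext[OF K B I(1), of \<phi> b] continuous_on_subset[OF \<phi>(1)] b(1)
      by auto
    have "norm X \<le> M * norm Y"
    proof (rule norm_bound)
      fix s
      show "norm (X s) \<le> M * norm Y"
      proof (cases "of_discrete s \<in> K")
        case True
        \<comment> \<open>At each point of \<open>K\<close> the value of \<open>X\<close> is a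
          convex combination of lifts of norm at most \<open>M * norm Y\<close>.\<close>
        have "norm (X s) \<le> (\<Sum>i\<in>I. \<phi> i (of_discrete s) * (M * norm Y))"
          using True \<phi>(2) b(3) by (auto simp: X(2) intro!: sum_norm_le mult_left_mono)
        also have "\<dots> = M * norm Y" using \<phi>(3)[OF True] by (simp flip: sum_distrib_right)
        finally show ?thesis .
      qed (simp add: X(2) M(1))
    qed
    moreover have "norm (Y - ?T X) \<le> norm Y / 2"
    proof (rule norm_bound)
      fix s
      show "norm ((Y - ?T X) s) \<le> norm Y / 2"
      proof (cases "of_discrete s \<in> K")
        case True
        have "?T X s = (\<Sum>i\<in>I. \<phi> i (of_discrete s) *\<^sub>R Y (discrete i))"
          using True star_hom_sum_scaleR[OF B g I(1), of b] b(1,2)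
          by (simp add: apply_cauchy_map[OF K B g X(1)] X(2))
        then show ?thesis using le[OF True] by (simp add: of_discrete_inverse)
      next
        case False
        then show ?thesis
          using Y' by (simp add: apply_cauchy_map[OF K B g X(1)] X(2) star_hom_0[OF B g]
              uc_functions_def)
      qed
    qed
    ultimately show ?thesis using X(1) by blast
  qed
  show "?F \<subseteq> ?T ` ?E"
  proof
    fix Y assume Y: "Y \<in> ?F"
    have le: "norm (?T X) \<le> 1 * norm X" if "X \<in> ?E" for X
      using star_hom_contractive[OF csB T that] by simp
    obtain X where "X \<in> ?E" "?T X = Y"
      by (rule approximate_lift_imp_lift[OF cstarD(1)[OF csB] cstar_subspace[OF csB]
            cstar_subspace[OF csC] im star_homD(2)[OF T] le M(1) lift Y])
    then show "Y \<in> ?T ` ?E" by blast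
  qed
qed

theorem theorem1:
  fixes K :: "real set"
    and A :: "'a::cstar_algebra set"
    and B :: "'b::cstar_algebra set"
    and C :: "'c::cstar_algebra set"
    and f :: "'a \<Rightarrow> 'b"
    and g :: "'b \<Rightarrow> 'c"
  assumes "K \<subseteq> {-1..1}"
    and "0 islimpt K"
    and "short_exact A f B g C"
  shows "short_exact (cauchy_ext K A) (cauchy_map K A f) (cauchy_ext K B) (cauchy_map K B g)
           (cauchy_ext K C)"
proof -
  note K = assms(1)
  have A: "cstar A" and B: "cstar B" and C: "cstar C" and f: "star_hom A B f"
    and g: "star_hom B C g" and inj: "inj_on f A" and ker: "f ` A = {b \<in> B. g b = 0}"
    and surj: "g ` B = C"
    using assms(3) by (simp_all add: short_exact_def)
  let ?f = "cauchy_map K A f" and ?g = "cauchy_map K B g"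
  have "?f ` cauchy_ext K A = {G \<in> cauchy_ext K B. ?g G = 0}"
  proof (intro subset_antisym subsetI)
    fix G assume "G \<in> ?f ` cauchy_ext K A"
    then obtain F where F: "F \<in> cauchy_ext K A" "G = ?f F" by blast
    have G: "G \<in> cauchy_ext K B" using star_homD(1)[OF star_hom_cauchy_map[OF K A B f]] F by simp
    have "?g G = 0"
    proof (rule bcontfun_eqI)
      fix s
      have "f (F s) \<in> {b \<in> B. g b = 0}"
        using cauchy_ext_apply_closed[OF K A F(1)] ker by blast
      then show "?g G s = apply_bcontfun 0 s"
        unfolding apply_cauchy_map[OF K B g G]
        by (simp add: F(2) apply_cauchy_map[OF K A f F(1)])
    qed
    with G show "G \<in> {G \<in> cauchy_ext K B. ?g G = 0}" by simp
  next
    fix G assume "G \<in> {G \<in> cauchy_ext K B. ?g G = 0}"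
    then have G: "G \<in> cauchy_ext K B" "?g G = 0" by auto
    \<comment> \<open>Evaluating \<open>?g G = 0\<close> at \<open>s\<close> places
      \<open>G s\<close> in the kernel of \<open>g\<close>, which is the range of
      \<open>f\<close>.\<close>
    have "G s \<in> f ` A" for s
      using arg_cong[OF G(2), of "\<lambda>H. apply_bcontfun H s"] cauchy_ext_apply_closed[OF K B G(1)]
      by (simp add: ker apply_cauchy_map[OF K B g G(1)])
    then show "G \<in> ?f ` cauchy_ext K A"
      using closed_kernel[OF B g]
      by (intro cauchy_map_lift_range[OF K A B f inj _ G(1)]) (simp_all add: ker)
  qed
  then show ?thesis
    by (simp add: short_exact_def cstar_cauchy_ext A B C K star_hom_cauchy_map[OF K A B f]
        star_hom_cauchy_map[OF K B C g] inj_on_cauchy_map[OF K A f inj]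
        surj_cauchy_map[OF K B C g surj])
qed

end
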